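(* For any cryptographic collision-resistant hash function $h:\{0,1\}^*\to\mathbb{G}$ (used as the basename hash of the scheme), Brickell and Li's pairing-based DAA scheme is an instantly linkable DAA scheme if, for a signature $\sigma=(\sigma_1,\ldots,\sigma_9)$, one defines $\mathsf{NymExtract}(\sigma):=\sigma_2$, $\mathsf{NymGen}(\mathit{sk}_S,\mathit{dom}):=h(\mathit{dom})^{\mathit{sk}_S}$, and $\mathsf{VerifyBsn}(\sigma,\mathit{dom}):=1$ if $\sigma_1=h(\mathit{dom})$ and $0$ otherwise.
   Context: **DAA schemes.** A direct anonymous attestation scheme has algorithms $\mathsf{Setup}_{\mathsf{DAA}}$, $\mathsf{Sign}_{\mathsf{DAA}}(\mathit{sk}_S,\mathit{cred}_S,\mathit{dom},m)$, $\mathsf{Verify}_{\mathsf{DAA}}(\mathit{pk}_I,m,\mathit{dom},\sigma,RL)$ ($RL$ a list of revoked secret keys, $RL_\emptyset$ the empty list), $\mathsf{Link}_{\mathsf{DAA}}(\sigma_0,\sigma_1)$ ($1$ = linked, $0$ = unlinked, $\bot$ = invalid input) and a protocol by which an issuer gives a signer with secret key $\mathit{sk}_S$ a credential $\mathit{cred}_S$. Only basenames $\mathit{dom}\in\{0,1\}^*$, $\mathit{dom}\neq\bot$, are used. **Instantly linkable.** A DAA scheme is instantly linkable if: (1) there is a deterministic poly-time algorithm $\mathsf{NymGen}$ with $\mathsf{NymGen}(\mathit{sk}_S,\mathit{dom})=\mathsf{NymExtract}(\mathsf{Sign}_{\mathsf{DAA}}(\mathit{sk}_S,\mathit{cred},\mathit{dom},\cdot))$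 (independently of the signed data); (2) there is a deterministic poly-time algorithm $\mathsf{NymExtract}$ such that for all valid signatures $\sigma_1,\sigma_2$, $\mathsf{Link}_{\mathsf{DAA}}(\sigma_1,\sigma_2)=1$ iff $\mathsf{NymExtract}(\sigma_1)=\mathsf{NymExtract}(\sigma_2)$; (3) the basename used to create a signature can be checked without knowing the signed data and is uniquely defined by the signature: there is a poly-time algorithm $\mathsf{VerifyBsn}$ such that for every PPT $A$ the probability $$\Pr[(\mathit{dom},\mathit{dom}',\sigma,\mathit{pk}_I,m)\leftarrow A(1^\lambda):\ \mathit{dom}\ne\mathit{dom}',\ \mathsf{VerifyBsn}(\sigma,\mathit{dom}')=1=\mathsf{VerifyBsn}(\sigma,\mathit{dom}),\ \mathsf{Verify}_{\mathsf{DAA}}(\mathit{pk}_I,m,\mathit{dom},\sigma,RL_\emptyset)=1]$$ is negligible in $\lambda$. **Brickell and Li's scheme.** Let $\mathbb{G}_1,\mathbb{G}_2,\mathbb{G}_T$ be groups of prime order $q$ with a bilinear pairing $e:\mathbb{G}_1\times\mathbb{G}_2\to\mathbb{G}_T$ and generators $g_1,g_2$; $\mathbb{G}$ a group of order $q$; $H$ a hash function into $\mathbb{Z}_q$; $h:\{0,1\}^*\to\mathbb{G}$ the basename hash. The issuer picks $h_1,h_2\in\mathbb{G}_1$ at random and a secret $\gamma\in\mathbb{Z}_q^*$, sets $w=g_2^\gamma$, $T_1=e(g_1,g_2)$, $T_2=e(h_1,g_2)$, $T_3=e(h_2,g_2)$, $T_4=e(h_2,w)$; these (except $\gamma$) form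 $\mathit{pk}_I$. - *Join/issue:* a signer with key $\mathit{sk}_S=f\in\mathbb{Z}_q^*$ sends $F=h_1^f$ with a Schnorr-type proof of knowledge of $f$; the issuer picks $x\in\mathbb{Z}_q$ and returns $\mathit{cred}_S=(A,x)$ with $A=(g_1F)^{1/(\gamma+x)}$. - *Sign:* set $J=h(\mathit{dom})$ and $K=J^f$; pick $a\in\mathbb{Z}_q$, $b=ax$, $T=A\,h_2^a$; pick $r_f,r_x,r_a,r_b\in\mathbb{Z}_q$, $R_1=J^{r_f}$, $R_2=e(T,g_2)^{-r_x}T_2^{r_f}T_3^{r_b}T_4^{r_a}$; with a random nonce $n$, compute a hash challenge $c$ from $(\mathit{pk}_I,J,K,T,R_1,R_2)$, $n$ and $m$; $s_y=r_y+cy$ for $y\in\{f,x,a,b\}$. The signature is $\sigma=(\sigma_1,\dots,\sigma_9)=(J,K,T,c,n,s_f,s_x,s_a,s_b)$, so $\sigma_1=h(\mathit{dom})$ and $\sigma_2=h(\mathit{dom})^f$ is the pseudonym. - *Verify:* check group/ring membership of the components, $J=h(\mathit{dom})$, $K\neq J^{f'}$ for all $f'\in RL$, and that $c$ is the challenge obtained from $\hat R_1=J^{s_f}K^{-c}$ and $\hat R_2=e(T,g_2^{-s_x}w^{-c})\,T_1^{c}\,T_2^{s_f}T_3^{s_b}T_4^{s_a}$ in place of $R_1,R_2$. - *Link:* for two valid signatures, output $1$ iff their pseudonyms (second components) are equal, else $0$; output $\bot$ if a signature is invalid. *)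

theory Defs
  imports
    "HOL-Probability.Probability"
    "HOL-Algebra.Generated_Groups"
    "HOL-Computational_Algebra.Computational_Algebra"
    "HOL-Number_Theory.Modular_Inverse"
begin

type_synonym bits = "bool list"

section \<open>Polynomial time\<close>

text \<open>
  The machine model is a multi-stack machine, given by structured programs over registers that hold
  bit strings and are accessed one bit at a time, at unit cost.  Finitely many registers occur in a
  program, so it simulates, and is simulated by, multi-tape Turing machines with polynomial overhead.
\<close>

datatype prog =
    Skip
  | Push nat bool
  | Pop nat
  | Seq prog prog
  | Branch nat prog prog prog
  | While nat prog

type_synonym store = "nat \<Rightarrow> bits"

text \<open>
  \<open>exec c s t s'\<close>: started in store \<open>s\<close>, program \<open>c\<close> halts after \<open>t\<close> steps in store \<open>s'\<close>.
  \<open>Branch x\<close> distinguishes whether register \<open>x\<close> is empty, starts with 0, or starts with 1;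
  \<open>While x\<close> iterates as long as register \<open>x\<close> is non-empty.
\<close>

inductive exec :: "prog \<Rightarrow> store \<Rightarrow> nat \<Rightarrow> store \<Rightarrow> bool" where
  exec_Skip: "exec Skip s 1 s"
| exec_Push: "exec (Push x b) s 1 (s(x := b # s x))"
| exec_Pop: "exec (Pop x) s 1 (s(x := tl (s x)))"
| exec_Seq: "exec c s t s' \<Longrightarrow> exec d s' u s'' \<Longrightarrow> exec (Seq c d) s (t + u) s''"
| exec_Branch:
    "exec (case s x of [] \<Rightarrow> c | b # _ \<Rightarrow> if b then c1 else c0) s t s' \<Longrightarrow>
     exec (Branch x c c0 c1) s (Suc t) s'"
| exec_While_done: "s x = [] \<Longrightarrow> exec (While x c) s 1 s"
| exec_While_step:
    "s x \<noteq> [] \<Longrightarrow> exec c s t s' \<Longrightarrow> exec (While x c) s' u s'' \<Longrightarrow>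
     exec (While x c) s (Suc (t + u)) s''"

definition load :: "bits list \<Rightarrow> store" where
  "load xs = (\<lambda>i. if i < length xs then xs ! i else [])"

text \<open>
  One program maps, for every instance \<open>i \<in> I\<close>, the tuple of bit strings \<open>inp i\<close> to the tuple
  \<open>out i\<close> in time polynomial in the total length of \<open>inp i\<close>.  Since programs are deterministic, this
  forces \<open>out i\<close> to be a function of \<open>inp i\<close>.
\<close>

definition poly_time :: "'i set \<Rightarrow> ('i \<Rightarrow> bits list) \<Rightarrow> ('i \<Rightarrow> bits list) \<Rightarrow> bool" where
  "poly_time I inp out \<longleftrightarrow>
     (\<exists>c (p :: nat poly) k. \<forall>i\<in>I. \<exists>t s.
        exec c (load (inp i)) t s \<and>
        t \<le> poly p (sum_list (map length (inp i))) \<and>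
        out i = map s [0..<k])"

text \<open>The unary security parameter.\<close>

definition unary :: "nat \<Rightarrow> bits" where
  "unary \<eta> = replicate \<eta> True"

text \<open>
  A probabilistic polynomial-time algorithm on input \<open>1\<^sup>\<eta>\<close>, given by its output distributions: a
  deterministic polynomial-time algorithm with a uniformly random tape of polynomial length as
  auxiliary input.
\<close>

definition ppt :: "(nat \<Rightarrow> bits list pmf) \<Rightarrow> bool" where
  "ppt A \<longleftrightarrow>
     (\<exists>(l :: nat poly) f.
        poly_time {(\<eta>, r). length r = poly l \<eta>} (\<lambda>(\<eta>, r). [unary \<eta>, r]) f \<and>
        (\<forall>\<eta>. A \<eta> = map_pmf (\<lambda>r. f (\<eta>, r)) (pmf_of_set {r. length r = poly l \<eta>})))"

definition negligible_fun :: "(nat \<Rightarrow> real) \<Rightarrow> bool" where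
  "negligible_fun f \<longleftrightarrow> (\<forall>d::nat. \<forall>\<^sub>F \<eta> in sequentially. \<bar>f \<eta>\<bar> < 1 / real \<eta> ^ d)"

text \<open>Little-endian binary notation.\<close>

fun bin :: "nat \<Rightarrow> bits" where
  "bin n = (if n = 0 then [] else odd n # bin (n div 2))"

declare bin.simps [simp del]

section \<open>Groups and hash functions\<close>

text \<open>
  Group elements are represented by bit strings, so that they can be given to and returned by
  algorithms.
\<close>

definition efficient_group :: "(nat \<Rightarrow> bits monoid) \<Rightarrow> bool" where
  "efficient_group G \<longleftrightarrow>
     (\<exists>p :: nat poly. \<forall>\<eta>. \<forall>x\<in>carrier (G \<eta>). length x \<le> poly p \<eta>) \<and>
     poly_time {(\<eta>, x, y). x \<in> carrier (G \<eta>) \<and> y \<in> carrier (G \<eta>)}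
       (\<lambda>(\<eta>, x, y). [unary \<eta>, x, y]) (\<lambda>(\<eta>, x, y). [x \<otimes>\<^bsub>G \<eta>\<^esub> y])"

definition collision_resistant :: "(nat \<Rightarrow> bits \<Rightarrow> bits) \<Rightarrow> bool" where
  "collision_resistant h \<longleftrightarrow>
     (\<forall>A. ppt A \<longrightarrow>
        negligible_fun (\<lambda>\<eta>. measure_pmf.prob (A \<eta>)
          {out. \<exists>x x'. out = [x, x'] \<and> x \<noteq> x' \<and> h \<eta> x = h \<eta> x'}))"

definition cr_hash :: "(nat \<Rightarrow> bits monoid) \<Rightarrow> (nat \<Rightarrow> bits \<Rightarrow> bits) \<Rightarrow> bool" where
  "cr_hash G h \<longleftrightarrow>
     (\<forall>\<eta> x. h \<eta> x \<in> carrier (G \<eta>)) \<and>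
     poly_time UNIV (\<lambda>(\<eta>, x). [unary \<eta>, x]) (\<lambda>(\<eta>, x). [h \<eta> x]) \<and>
     collision_resistant h"

section \<open>DAA schemes\<close>

text \<open>
  All algorithms depend on the security parameter.  \<open>daa_setup\<close> generates the issuer's key pair;
  \<open>daa_join\<close> is the distribution of the outcome of the join protocol between an honest signer and an
  honest issuer (\<open>None\<close> if no credential is issued).  \<open>Some True\<close>, \<open>Some False\<close> and \<open>None\<close> as results
  of \<open>daa_link\<close> stand for linked, unlinked and invalid input.  The last three components encode the
  objects handled by algorithms as tuples of bit strings.
\<close>

record ('pk, 'isk, 'sk, 'cred, 'sig) daa_scheme =
  daa_setup :: "nat \<Rightarrow> ('pk \<times> 'isk) pmf"
  daa_keys :: "nat \<Rightarrow> 'sk set"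
  daa_join :: "nat \<Rightarrow> 'pk \<Rightarrow> 'isk \<Rightarrow> 'sk \<Rightarrow> 'cred option pmf"
  daa_sign :: "nat \<Rightarrow> 'pk \<Rightarrow> 'sk \<Rightarrow> 'cred \<Rightarrow> bits \<Rightarrow> bits \<Rightarrow> 'sig pmf"
  daa_verify :: "nat \<Rightarrow> 'pk \<Rightarrow> bits \<Rightarrow> bits \<Rightarrow> 'sig \<Rightarrow> 'sk list \<Rightarrow> bool"
  daa_link :: "nat \<Rightarrow> 'sig \<Rightarrow> 'sig \<Rightarrow> bool option"
  enc_pk :: "'pk \<Rightarrow> bits list"
  enc_sk :: "'sk \<Rightarrow> bits list"
  enc_sig :: "'sig \<Rightarrow> bits list"

text \<open>
  Arguments of \<open>daa_sign\<close>: issuer public key, secret key, credential, basename, message.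
  Arguments of \<open>daa_verify\<close>: issuer public key, message, basename, signature, revoked keys.
\<close>

definition valid_sig :: "('pk, 'isk, 'sk, 'cred, 'sig) daa_scheme \<Rightarrow> nat \<Rightarrow> 'sig \<Rightarrow> bool" where
  "valid_sig S \<eta> \<sigma> \<longleftrightarrow> (\<exists>pk m bsn. daa_verify S \<eta> pk m bsn \<sigma> [])"

definition ambiguous_bsn ::
  "('pk, 'isk, 'sk, 'cred, 'sig) daa_scheme \<Rightarrow> (nat \<Rightarrow> 'sig \<Rightarrow> bits \<Rightarrow> bool) \<Rightarrow> nat \<Rightarrow> bits list set"
where
  "ambiguous_bsn S VerifyBsn \<eta> =
     {out. \<exists>bsn bsn' \<sigma> pk m.
        out = [bsn, bsn'] @ enc_sig S \<sigma> @ enc_pk S pk @ [m] \<and>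
        bsn \<noteq> bsn' \<and> VerifyBsn \<eta> \<sigma> bsn' \<and> VerifyBsn \<eta> \<sigma> bsn \<and>
        daa_verify S \<eta> pk m bsn \<sigma> []}"

text \<open>
  The conjuncts are grouped by the three requirements on NymGen, NymExtract and VerifyBsn.  The second
  conjunct of the third group says that VerifyBsn accepts the basename used to create a signature.
\<close>

definition instantly_linkable_via ::
  "('pk, 'isk, 'sk, 'cred, 'sig) daa_scheme \<Rightarrow> (nat \<Rightarrow> 'sk \<Rightarrow> bits \<Rightarrow> bits) \<Rightarrow>
   (nat \<Rightarrow> 'sig \<Rightarrow> bits) \<Rightarrow> (nat \<Rightarrow> 'sig \<Rightarrow> bits \<Rightarrow> bool) \<Rightarrow> bool"
where
  "instantly_linkable_via S NymGen NymExtract VerifyBsn \<longleftrightarrow>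
     (poly_time {(\<eta>, sk, bsn). sk \<in> daa_keys S \<eta>}
        (\<lambda>(\<eta>, sk, bsn). [unary \<eta>] @ enc_sk S sk @ [bsn]) (\<lambda>(\<eta>, sk, bsn). [NymGen \<eta> sk bsn]) \<and>
      (\<forall>\<eta> pk cred bsn m. \<forall>sk\<in>daa_keys S \<eta>. \<forall>\<sigma>\<in>set_pmf (daa_sign S \<eta> pk sk cred bsn m).
         NymGen \<eta> sk bsn = NymExtract \<eta> \<sigma>)) \<and>
     (poly_time UNIV
        (\<lambda>(\<eta>, \<sigma>). [unary \<eta>] @ enc_sig S \<sigma>) (\<lambda>(\<eta>, \<sigma>). [NymExtract \<eta> \<sigma>]) \<and>
      (\<forall>\<eta> \<sigma>\<^sub>1 \<sigma>\<^sub>2. valid_sig S \<eta> \<sigma>\<^sub>1 \<longrightarrow> valid_sig S \<eta> \<sigma>\<^sub>2 \<longrightarrow>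
         (daa_link S \<eta> \<sigma>\<^sub>1 \<sigma>\<^sub>2 = Some True \<longleftrightarrow> NymExtract \<eta> \<sigma>\<^sub>1 = NymExtract \<eta> \<sigma>\<^sub>2))) \<and>
     (poly_time UNIV
        (\<lambda>(\<eta>, \<sigma>, bsn). [unary \<eta>] @ enc_sig S \<sigma> @ [bsn]) (\<lambda>(\<eta>, \<sigma>, bsn). [[VerifyBsn \<eta> \<sigma> bsn]]) \<and>
      (\<forall>\<eta> pk cred bsn m. \<forall>sk\<in>daa_keys S \<eta>. \<forall>\<sigma>\<in>set_pmf (daa_sign S \<eta> pk sk cred bsn m).
         VerifyBsn \<eta> \<sigma> bsn) \<and>
      (\<forall>A. ppt A \<longrightarrow>
         negligible_fun (\<lambda>\<eta>. measure_pmf.prob (A \<eta>) (ambiguous_bsn S VerifyBsn \<eta>))))"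

section \<open>Brickell and Li's scheme\<close>

text \<open>
  Public parameters for a fixed security parameter.  \<open>pp_J\<close> is the group of the pseudonyms.  The
  hash function \<open>pp_H\<close> takes tuples of bit strings; as it is arbitrary, this covers every way of
  encoding or successively hashing the components.  \<open>pp_nlen\<close> is the length of nonces.
\<close>

record bl_params =
  pp_q :: nat
  pp_G1 :: "bits monoid"
  pp_G2 :: "bits monoid"
  pp_GT :: "bits monoid"
  pp_J :: "bits monoid"
  pp_e :: "bits \<Rightarrow> bits \<Rightarrow> bits"
  pp_g1 :: bits
  pp_g2 :: bits
  pp_H :: "bits list \<Rightarrow> nat"
  pp_nlen :: nat

definition bl_params_ok :: "bl_params \<Rightarrow> bool" where
  "bl_params_ok P \<longleftrightarrow>
     prime (pp_q P) \<and>
     group (pp_G1 P) \<and> order (pp_G1 P) = pp_q P \<and>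
     group (pp_G2 P) \<and> order (pp_G2 P) = pp_q P \<and>
     group (pp_GT P) \<and> order (pp_GT P) = pp_q P \<and>
     group (pp_J P) \<and> order (pp_J P) = pp_q P \<and>
     pp_g1 P \<in> carrier (pp_G1 P) \<and> generate (pp_G1 P) {pp_g1 P} = carrier (pp_G1 P) \<and>
     pp_g2 P \<in> carrier (pp_G2 P) \<and> generate (pp_G2 P) {pp_g2 P} = carrier (pp_G2 P) \<and>
     (\<forall>x\<in>carrier (pp_G1 P). \<forall>y\<in>carrier (pp_G2 P). pp_e P x y \<in> carrier (pp_GT P)) \<and>
     (\<forall>x\<in>carrier (pp_G1 P). \<forall>x'\<in>carrier (pp_G1 P). \<forall>y\<in>carrier (pp_G2 P).
        pp_e P (x \<otimes>\<^bsub>pp_G1 P\<^esub> x') y = pp_e P x y \<otimes>\<^bsub>pp_GT P\<^esub> pp_e P x' y) \<and>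
     (\<forall>x\<in>carrier (pp_G1 P). \<forall>y\<in>carrier (pp_G2 P). \<forall>y'\<in>carrier (pp_G2 P).
        pp_e P x (y \<otimes>\<^bsub>pp_G2 P\<^esub> y') = pp_e P x y \<otimes>\<^bsub>pp_GT P\<^esub> pp_e P x y') \<and>
     pp_e P (pp_g1 P) (pp_g2 P) \<noteq> \<one>\<^bsub>pp_GT P\<^esub> \<and>
     (\<forall>xs. pp_H P xs < pp_q P)"

text \<open>
  Elements of \<open>\<int>\<^sub>q\<close> are represented by their representatives in \<open>{..<q}\<close>.
\<close>

record bl_pk =
  ipk_h1 :: bits
  ipk_h2 :: bits
  ipk_w :: bits
  ipk_T1 :: bits
  ipk_T2 :: bits
  ipk_T3 :: bits
  ipk_T4 :: bits

record bl_sig =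
  sig_J :: bits
  sig_K :: bits
  sig_T :: bits
  sig_c :: nat
  sig_n :: bits
  sig_f :: nat
  sig_x :: nat
  sig_a :: nat
  sig_b :: nat

definition bl_enc_pk :: "bl_pk \<Rightarrow> bits list" where
  "bl_enc_pk pk =
     [ipk_h1 pk, ipk_h2 pk, ipk_w pk, ipk_T1 pk, ipk_T2 pk, ipk_T3 pk, ipk_T4 pk]"

definition bl_enc_sig :: "bl_sig \<Rightarrow> bits list" where
  "bl_enc_sig \<sigma> =
     [sig_J \<sigma>, sig_K \<sigma>, sig_T \<sigma>, bin (sig_c \<sigma>), sig_n \<sigma>,
      bin (sig_f \<sigma>), bin (sig_x \<sigma>), bin (sig_a \<sigma>), bin (sig_b \<sigma>)]"

definition bl_setup :: "bl_params \<Rightarrow> (bl_pk \<times> nat) pmf" where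
  "bl_setup P = do {
     h1 \<leftarrow> pmf_of_set (carrier (pp_G1 P));
     h2 \<leftarrow> pmf_of_set (carrier (pp_G1 P));
     \<gamma> \<leftarrow> pmf_of_set {1..<pp_q P};
     let w = pp_g2 P [^]\<^bsub>pp_G2 P\<^esub> \<gamma>;
     return_pmf
       (\<lparr>ipk_h1 = h1, ipk_h2 = h2, ipk_w = w,
         ipk_T1 = pp_e P (pp_g1 P) (pp_g2 P), ipk_T2 = pp_e P h1 (pp_g2 P),
         ipk_T3 = pp_e P h2 (pp_g2 P), ipk_T4 = pp_e P h2 w\<rparr>, \<gamma>)
   }"

text \<open>
  The signer's message in the join protocol: \<open>F\<close> with a non-interactive Schnorr proof \<open>(c, s)\<close>, and
  the issuer's answer.  No credential is issued if the proof does not verify or if \<open>\<gamma> + x\<close> is not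
  invertible modulo \<open>q\<close>.
\<close>

definition bl_join_request :: "bl_params \<Rightarrow> bl_pk \<Rightarrow> nat \<Rightarrow> (bits \<times> nat \<times> nat) pmf" where
  "bl_join_request P pk f = do {
     r \<leftarrow> pmf_of_set {..<pp_q P};
     let F = ipk_h1 pk [^]\<^bsub>pp_G1 P\<^esub> f;
     let R = ipk_h1 pk [^]\<^bsub>pp_G1 P\<^esub> r;
     let c = pp_H P (bl_enc_pk pk @ [F, R]);
     return_pmf (F, c, (r + c * f) mod pp_q P)
   }"

definition bl_join_issue ::
  "bl_params \<Rightarrow> bl_pk \<Rightarrow> nat \<Rightarrow> bits \<times> nat \<times> nat \<Rightarrow> (bits \<times> nat) option pmf" where
  "bl_join_issue P pk \<gamma> = (\<lambda>(F, c, s). do {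
     let R = ipk_h1 pk [^]\<^bsub>pp_G1 P\<^esub> s \<otimes>\<^bsub>pp_G1 P\<^esub> F [^]\<^bsub>pp_G1 P\<^esub> (- int c);
     x \<leftarrow> pmf_of_set {..<pp_q P};
     return_pmf
       (if F \<in> carrier (pp_G1 P) \<and> s < pp_q P \<and> c = pp_H P (bl_enc_pk pk @ [F, R]) \<and>
           \<not> pp_q P dvd \<gamma> + x
        then Some ((pp_g1 P \<otimes>\<^bsub>pp_G1 P\<^esub> F) [^]\<^bsub>pp_G1 P\<^esub> modular_inverse (pp_q P) (\<gamma> + x), x)
        else None)
   })"

definition bl_join :: "bl_params \<Rightarrow> bl_pk \<Rightarrow> nat \<Rightarrow> nat \<Rightarrow> (bits \<times> nat) option pmf" where
  "bl_join P pk \<gamma> f = bind_pmf (bl_join_request P pk f) (bl_join_issue P pk \<gamma>)"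

definition bl_challenge ::
  "bl_params \<Rightarrow> bl_pk \<Rightarrow> bits \<Rightarrow> bits \<Rightarrow> bits \<Rightarrow> bits \<Rightarrow> bits \<Rightarrow> bits \<Rightarrow> bits \<Rightarrow> nat" where
  "bl_challenge P pk J K T R1 R2 n m = pp_H P (bl_enc_pk pk @ [J, K, T, R1, R2, n, m])"

definition bl_sign ::
  "bl_params \<Rightarrow> (bits \<Rightarrow> bits) \<Rightarrow> bl_pk \<Rightarrow> nat \<Rightarrow> bits \<times> nat \<Rightarrow> bits \<Rightarrow> bits \<Rightarrow> bl_sig pmf" where
  "bl_sign P h pk f cred bsn m = do {
     let (A, x) = cred;
     let q = pp_q P;
     let J = h bsn;
     let K = J [^]\<^bsub>pp_J P\<^esub> f;
     a \<leftarrow> pmf_of_set {..<q};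
     let b = a * x mod q;
     let T = A \<otimes>\<^bsub>pp_G1 P\<^esub> ipk_h2 pk [^]\<^bsub>pp_G1 P\<^esub> a;
     rf \<leftarrow> pmf_of_set {..<q};
     rx \<leftarrow> pmf_of_set {..<q};
     ra \<leftarrow> pmf_of_set {..<q};
     rb \<leftarrow> pmf_of_set {..<q};
     let R1 = J [^]\<^bsub>pp_J P\<^esub> rf;
     let R2 = pp_e P T (pp_g2 P) [^]\<^bsub>pp_GT P\<^esub> (- int rx) \<otimes>\<^bsub>pp_GT P\<^esub> ipk_T2 pk [^]\<^bsub>pp_GT P\<^esub> rf
              \<otimes>\<^bsub>pp_GT P\<^esub> ipk_T3 pk [^]\<^bsub>pp_GT P\<^esub> rb \<otimes>\<^bsub>pp_GT P\<^esub> ipk_T4 pk [^]\<^bsub>pp_GT P\<^esub> ra;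
     n \<leftarrow> pmf_of_set {n. length n = pp_nlen P};
     let c = bl_challenge P pk J K T R1 R2 n m;
     return_pmf
       \<lparr>sig_J = J, sig_K = K, sig_T = T, sig_c = c, sig_n = n,
        sig_f = (rf + c * f) mod q, sig_x = (rx + c * x) mod q,
        sig_a = (ra + c * a) mod q, sig_b = (rb + c * b) mod q\<rparr>
   }"

definition bl_verify ::
  "bl_params \<Rightarrow> (bits \<Rightarrow> bits) \<Rightarrow> bl_pk \<Rightarrow> bits \<Rightarrow> bits \<Rightarrow> bl_sig \<Rightarrow> nat list \<Rightarrow> bool" where
  "bl_verify P h pk m bsn \<sigma> RL \<longleftrightarrow>
     (let J = sig_J \<sigma>; K = sig_K \<sigma>; T = sig_T \<sigma>; c = sig_c \<sigma>;
          R1 = J [^]\<^bsub>pp_J P\<^esub> sig_f \<sigma> \<otimes>\<^bsub>pp_J P\<^esub> K [^]\<^bsub>pp_J P\<^esub> (- int c);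
          R2 = pp_e P T (pp_g2 P [^]\<^bsub>pp_G2 P\<^esub> (- int (sig_x \<sigma>))
                         \<otimes>\<^bsub>pp_G2 P\<^esub> ipk_w pk [^]\<^bsub>pp_G2 P\<^esub> (- int c))
               \<otimes>\<^bsub>pp_GT P\<^esub> ipk_T1 pk [^]\<^bsub>pp_GT P\<^esub> c \<otimes>\<^bsub>pp_GT P\<^esub> ipk_T2 pk [^]\<^bsub>pp_GT P\<^esub> sig_f \<sigma>
               \<otimes>\<^bsub>pp_GT P\<^esub> ipk_T3 pk [^]\<^bsub>pp_GT P\<^esub> sig_b \<sigma> \<otimes>\<^bsub>pp_GT P\<^esub> ipk_T4 pk [^]\<^bsub>pp_GT P\<^esub> sig_a \<sigma>
      in J \<in> carrier (pp_J P) \<and> K \<in> carrier (pp_J P) \<and> T \<in> carrier (pp_G1 P) \<and>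
         {c, sig_f \<sigma>, sig_x \<sigma>, sig_a \<sigma>, sig_b \<sigma>} \<subseteq> {..<pp_q P} \<and>
         J = h bsn \<and>
         (\<forall>f'\<in>set RL. K \<noteq> J [^]\<^bsub>pp_J P\<^esub> f') \<and>
         c = bl_challenge P pk J K T R1 R2 (sig_n \<sigma>) m)"

definition bl_link :: "bl_params \<Rightarrow> (bits \<Rightarrow> bits) \<Rightarrow> bl_sig \<Rightarrow> bl_sig \<Rightarrow> bool option" where
  "bl_link P h \<sigma>\<^sub>0 \<sigma>\<^sub>1 =
     (if (\<exists>pk m bsn. bl_verify P h pk m bsn \<sigma>\<^sub>0 []) \<and> (\<exists>pk m bsn. bl_verify P h pk m bsn \<sigma>\<^sub>1 [])
      then Some (sig_K \<sigma>\<^sub>0 = sig_K \<sigma>\<^sub>1) else None)"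

definition brickell_li ::
  "(nat \<Rightarrow> bl_params) \<Rightarrow> (nat \<Rightarrow> bits \<Rightarrow> bits) \<Rightarrow>
   (bl_pk, nat, nat, bits \<times> nat, bl_sig) daa_scheme" where
  "brickell_li P h =
     \<lparr>daa_setup = (\<lambda>\<eta>. bl_setup (P \<eta>)),
      daa_keys = (\<lambda>\<eta>. {1..<pp_q (P \<eta>)}),
      daa_join = (\<lambda>\<eta>. bl_join (P \<eta>)),
      daa_sign = (\<lambda>\<eta>. bl_sign (P \<eta>) (h \<eta>)),
      daa_verify = (\<lambda>\<eta>. bl_verify (P \<eta>) (h \<eta>)),
      daa_link = (\<lambda>\<eta>. bl_link (P \<eta>) (h \<eta>)),
      enc_pk = bl_enc_pk,
      enc_sk = (\<lambda>f. [bin f]),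
      enc_sig = bl_enc_sig\<rparr>"

definition bl_nym_gen ::
  "(nat \<Rightarrow> bl_params) \<Rightarrow> (nat \<Rightarrow> bits \<Rightarrow> bits) \<Rightarrow> nat \<Rightarrow> nat \<Rightarrow> bits \<Rightarrow> bits" where
  "bl_nym_gen P h \<eta> f bsn = h \<eta> bsn [^]\<^bsub>pp_J (P \<eta>)\<^esub> f"

definition bl_nym_extract :: "nat \<Rightarrow> bl_sig \<Rightarrow> bits" where
  "bl_nym_extract \<eta> \<sigma> = sig_K \<sigma>"

definition bl_verify_bsn :: "(nat \<Rightarrow> bits \<Rightarrow> bits) \<Rightarrow> nat \<Rightarrow> bl_sig \<Rightarrow> bits \<Rightarrow> bool" where
  "bl_verify_bsn h \<eta> \<sigma> bsn \<longleftrightarrow> sig_J \<sigma> = h \<eta> bsn"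

end

theory Submission
  imports Defs
begin

text \<open>
  The algebraic requirements hold by construction of the signatures; the content is the running time
  of the three algorithms and the uniqueness of the basename.  A program is turned into a subroutine
  by shifting its registers past those of the caller and erasing all of them except the result.  With
  the hash function and the group operation as subroutines, pseudonyms are computed by left-to-right
  square-and-multiply, which never needs the neutral element because the exponent is positive.
  Finally, a signature that is accepted for two basenames has a first component that is the hash value
  of both, so the two basenames are a collision.
\<close>

section \<open>Executions with upper bounds on the step count, which can be weakened\<close>

definition runs :: "prog \<Rightarrow> store \<Rightarrow> nat \<Rightarrow> store \<Rightarrow> bool" where
  "runs c s T s' \<longleftrightarrow> (\<exists>t\<le>T. exec c s t s')"

lemma runs_mono: "runs c s T s' \<Longrightarrow> T \<le> T' \<Longrightarrow> runs c s T' s'"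
  unfolding runs_def using order_trans by blast

lemma exec_runs: "exec c s t s' \<Longrightarrow> runs c s t s'"
  unfolding runs_def by blast

lemmas runs_Skip = exec_Skip[THEN exec_runs]
  and runs_Push = exec_Push[THEN exec_runs]
  and runs_Pop = exec_Pop[THEN exec_runs]
  and runs_While_done = exec_While_done[THEN exec_runs]

lemma runs_Seq: "runs c s T s' \<Longrightarrow> runs d s' U s'' \<Longrightarrow> runs (Seq c d) s (T + U) s''"
  unfolding runs_def by (elim exE conjE, rule exI, rule conjI[OF _ exec_Seq]) auto

lemma runs_Branch:
  "runs (case s x of [] \<Rightarrow> c | b # _ \<Rightarrow> if b then c1 else c0) s T s' \<Longrightarrow>
   runs (Branch x c c0 c1) s (Suc T) s'"
  unfolding runs_def by (elim exE conjE, rule exI, rule conjI[OF _ exec_Branch]) auto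

lemma runs_While_step:
  "s x \<noteq> [] \<Longrightarrow> runs c s T s' \<Longrightarrow> runs (While x c) s' U s'' \<Longrightarrow>
   runs (While x c) s (Suc (T + U)) s''"
  unfolding runs_def by (elim exE conjE, rule exI, rule conjI[OF _ exec_While_step]) auto

section \<open>Moving data between registers\<close>

definition clear :: "nat \<Rightarrow> prog" where
  "clear x = While x (Pop x)"

text \<open>Every bit costs one loop test and one \<open>Pop\<close>; the final test of the empty
  register accounts for the summand 1.\<close>

lemma runs_clear: "runs (clear x) s (2 * length (s x) + 1) (s(x := []))"
proof (induction "s x" arbitrary: s)
  case Nil
  note sx = Nil[symmetric]
  show ?case
    unfolding clear_def using runs_While_done[of s x, OF sx, of "Pop x"] by (simp add: sx fun_upd_idem)
next
  case (Cons b bs)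
  have "runs (clear x) (s(x := bs)) (2 * length bs + 1) (s(x := []))"
    using Cons.hyps(1)[of "s(x := bs)"] by simp
  moreover have "runs (Pop x) s 1 (s(x := bs))"
    using runs_Pop[of x s] Cons.hyps(2)[symmetric] by simp
  ultimately have "runs (clear x) s (Suc (1 + (2 * length bs + 1))) (s(x := []))"
    unfolding clear_def using Cons.hyps(2)[symmetric] by (intro runs_While_step) auto
  then show ?case
    using Cons.hyps(2)[symmetric] by simp
qed

primrec clears :: "nat list \<Rightarrow> prog" where
  "clears [] = Skip"
| "clears (x # xs) = Seq (clear x) (clears xs)"

text \<open>A common bound \<open>B\<close> makes the cost depend only on the number of registers;
  clearing one register keeps the bound for the others.\<close>

lemma runs_clears:
  assumes "\<And>x. x \<in> set xs \<Longrightarrow> length (s x) \<le> B"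
  shows "runs (clears xs) s (1 + length xs * (2 * B + 1)) (\<lambda>r. if r \<in> set xs then [] else s r)"
  using assms
proof (induction xs arbitrary: s)
  case Nil
  then show ?case using runs_Skip[of s] by simp
next
  case (Cons x xs)
  have "runs (clear x) s (2 * B + 1) (s(x := []))"
    by (rule runs_mono[OF runs_clear]) (use Cons.prems in simp)
  moreover have "runs (clears xs) (s(x := [])) (1 + length xs * (2 * B + 1))
      (\<lambda>r. if r \<in> set xs then [] else (s(x := [])) r)"
    by (rule Cons.IH) (use Cons.prems in simp)
  ultimately have "runs (clears (x # xs)) s ((2 * B + 1) + (1 + length xs * (2 * B + 1)))
      (\<lambda>r. if r \<in> set xs then [] else (s(x := [])) r)"
    by (simp only: clears.simps runs_Seq)
  moreover have "(\<lambda>r. if r \<in> set xs then [] else (s(x := [])) r) =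
      (\<lambda>r. if r \<in> set (x # xs) then [] else s r)"
    by auto
  ultimately show ?case by (simp add: algebra_simps)
qed

definition move_rev :: "nat \<Rightarrow> nat \<Rightarrow> prog" where
  "move_rev a b = While a (Seq (Branch a Skip (Push b False) (Push b True)) (Pop a))"

lemma runs_move_rev:
  assumes "a \<noteq> b"
  shows "runs (move_rev a b) s (4 * length (s a) + 1) (s(a := [], b := rev (s a) @ s b))"
proof (induction "s a" arbitrary: s)
  case Nil
  note sa = Nil[symmetric]
  show ?case
    unfolding move_rev_def using runs_While_done[of s a, OF sa] by (simp add: sa fun_upd_idem)
next
  case (Cons v vs)
  note sa = Cons.hyps(2)[symmetric]
  let ?s = "s(b := v # s b)"
  have "runs (Branch a Skip (Push b False) (Push b True)) s (Suc 1) ?s"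
    by (rule runs_Branch, cases v) (use runs_Push[of b v s] in \<open>simp_all add: sa\<close>)
  moreover have "runs (Pop a) ?s 1 (?s(a := vs))"
    using runs_Pop[of a ?s] assms sa by simp
  moreover have "runs (move_rev a b) (?s(a := vs)) (4 * length vs + 1)
      (s(a := [], b := rev vs @ v # s b))"
  proof -
    have "(?s(a := vs))(a := [], b := rev vs @ v # s b) = s(a := [], b := rev vs @ v # s b)"
      by (rule ext) simp
    then show ?thesis
      using Cons.hyps(1)[of "?s(a := vs)"] assms by simp
  qed
  ultimately have "runs (move_rev a b) s (Suc ((Suc 1 + 1) + (4 * length vs + 1)))
      (s(a := [], b := rev vs @ v # s b))"
    unfolding move_rev_def by (intro runs_While_step[OF _ runs_Seq]) (simp_all add: sa)
  then have "runs (move_rev a b) s (4 * length (v # vs) + 1)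
      (s(a := [], b := rev vs @ v # s b))"
    by (rule runs_mono) simp
  then show ?case by (simp add: sa)
qed

definition move_rev_both :: "nat \<Rightarrow> nat \<Rightarrow> nat \<Rightarrow> prog" where
  "move_rev_both t a b =
     While t (Seq (Branch t Skip (Seq (Push a False) (Push b False)) (Seq (Push a True) (Push b True)))
               (Pop t))"

lemma runs_move_rev_both:
  assumes "distinct [t, a, b]"
  shows "runs (move_rev_both t a b) s (5 * length (s t) + 1)
           (s(t := [], a := rev (s t) @ s a, b := rev (s t) @ s b))"
proof (induction "s t" arbitrary: s)
  case Nil
  note st = Nil[symmetric]
  show ?case
    unfolding move_rev_both_def using runs_While_done[of s t, OF st] by (simp add: st fun_upd_idem)
next
  case (Cons v vs)
  note st = Cons.hyps(2)[symmetric]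
  let ?s = "s(a := v # s a, b := v # s b)"
  have "runs (Seq (Push a v) (Push b v)) s (1 + 1) ?s"
    using runs_Seq[OF runs_Push[of a v s] runs_Push[of b v]] assms by simp
  then have "runs (Branch t Skip (Seq (Push a False) (Push b False)) (Seq (Push a True) (Push b True)))
      s (Suc (1 + 1)) ?s"
    by (intro runs_Branch) (cases v; simp add: st)
  moreover have "runs (Pop t) ?s 1 (?s(t := vs))"
    using runs_Pop[of t ?s] assms st by simp
  moreover have "runs (move_rev_both t a b) (?s(t := vs)) (5 * length vs + 1)
      (s(t := [], a := rev vs @ v # s a, b := rev vs @ v # s b))"
  proof -
    have "(?s(t := vs))(t := [], a := rev vs @ v # s a, b := rev vs @ v # s b) =
        s(t := [], a := rev vs @ v # s a, b := rev vs @ v # s b)"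
      by (rule ext) simp
    then show ?thesis
      using Cons.hyps(1)[of "?s(t := vs)"] assms by simp
  qed
  ultimately have "runs (move_rev_both t a b) s (Suc ((Suc (1 + 1) + 1) + (5 * length vs + 1)))
      (s(t := [], a := rev vs @ v # s a, b := rev vs @ v # s b))"
    unfolding move_rev_both_def by (intro runs_While_step[OF _ runs_Seq]) (simp_all add: st)
  then have "runs (move_rev_both t a b) s (5 * length (v # vs) + 1)
      (s(t := [], a := rev vs @ v # s a, b := rev vs @ v # s b))"
    by (rule runs_mono) simp
  then show ?case by (simp add: st)
qed

text \<open>A stack can be read only by emptying it, and moving its bits reverses them. So the
  source \<open>a\<close> is reversed into the scratch register \<open>t\<close> and reversed back
  into both \<open>a\<close> and the target \<open>b\<close>.\<close>

definition assign :: "nat \<Rightarrow> nat \<Rightarrow> nat \<Rightarrow> prog" where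
  "assign t b a = Seq (clear b) (Seq (move_rev a t) (move_rev_both t a b))"

text \<open>Each source bit costs 4 steps on the way to \<open>t\<close> and 5 on the way back; each
  old bit of the target costs 2.\<close>

lemma runs_assign_store:
  assumes "distinct [t, a, b]" "s t = []"
  shows "runs (assign t b a) s (9 * length (s a) + 2 * length (s b) + 3) (s(b := s a))"
proof -
  let ?s1 = "s(b := [])" and ?s2 = "s(b := [], a := [], t := rev (s a))"
  have "runs (move_rev a t) ?s1 (4 * length (s a) + 1) ?s2"
    using runs_move_rev[of a t ?s1] assms by simp
  moreover have "runs (move_rev_both t a b) ?s2 (5 * length (s a) + 1) (s(b := s a))"
  proof -
    \<comment> \<open>The scratch register ends up empty, which is its initial value, and the source
      regains its contents.\<close>
    have "?s2(t := [], a := s a, b := s a) = s(b := s a)"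
      by (rule ext) (use assms in simp)
    then show ?thesis
      using runs_move_rev_both[of t a b ?s2] assms by simp
  qed
  ultimately have "runs (assign t b a) s ((2 * length (s b) + 1) +
      ((4 * length (s a) + 1) + (5 * length (s a) + 1))) (s(b := s a))"
    unfolding assign_def by (intro runs_Seq[OF runs_clear] runs_Seq)
  then show ?thesis by (rule runs_mono) simp
qed

section \<open>Stores given by lists of registers\<close>

lemma load_nth: "i < length xs \<Longrightarrow> load xs i = xs ! i"
  by (simp add: load_def)

lemma load_update: "x < length xs \<Longrightarrow> (load xs)(x := v) = load (xs[x := v])"
  by (rule ext) (simp add: load_def)

text \<open>Registers past the end of a list are empty, so work registers can be made explicit at
  its end and then fall within the range of \<open>load_update\<close>.\<close>

lemma load_append_Nil: "load (xs @ [[]]) = load xs"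
  by (rule ext) (simp add: load_def nth_append less_Suc_eq)

lemma load_append_Nils: "load (xs @ replicate n []) = load xs"
  by (rule ext) (simp add: load_def nth_append)

lemma runs_assign:
  assumes "distinct [t, a, b]" "a < length xs" "b < length xs" "t < length xs" "xs ! t = []"
    "length (xs ! a) \<le> B" "length (xs ! b) \<le> B"
  shows "runs (assign t b a) (load xs) (11 * B + 3) (load (xs[b := xs ! a]))"
proof -
  have "runs (assign t b a) (load xs) (9 * length (load xs a) + 2 * length (load xs b) + 3)
      ((load xs)(b := load xs a))"
    by (rule runs_assign_store) (use assms in \<open>auto simp: load_def\<close>)
  moreover have "load xs a = xs ! a" "load xs b = xs ! b"
    using assms by (simp_all add: load_def)
  ultimately have "runs (assign t b a) (load xs) (9 * length (xs ! a) + 2 * length (xs ! b) + 3)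
      (load (xs[b := xs ! a]))"
    using assms by (simp add: load_update)
  then show ?thesis
    by (rule runs_mono) (use assms in linarith)
qed

section \<open>Subroutines\<close>

primrec shift :: "nat \<Rightarrow> prog \<Rightarrow> prog" where
  "shift N Skip = Skip"
| "shift N (Push x b) = Push (N + x) b"
| "shift N (Pop x) = Pop (N + x)"
| "shift N (Seq c d) = Seq (shift N c) (shift N d)"
| "shift N (Branch x c c0 c1) = Branch (N + x) (shift N c) (shift N c0) (shift N c1)"
| "shift N (While x c) = While (N + x) (shift N c)"

definition embed :: "nat \<Rightarrow> store \<Rightarrow> store \<Rightarrow> store" where
  "embed N s0 s = (\<lambda>r. if r < N then s0 r else s (r - N))"

lemma embed_add [simp]: "embed N s0 s (N + x) = s x"
  by (simp add: embed_def)

lemma embed_update: "(embed N s0 s)(N + x := v) = embed N s0 (s(x := v))"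
  by (rule ext) (auto simp: embed_def)

text \<open>Every register access of the shifted program lands in the embedded store and acts there
  as in the original run, at the same cost.\<close>

lemma exec_shift: "exec c s t s' \<Longrightarrow> exec (shift N c) (embed N s0 s) t (embed N s0 s')"
proof (induction rule: exec.induct)
  case (exec_Push x b s)
  then show ?case
    using exec.exec_Push[of "N + x" b "embed N s0 s"]
    unfolding shift.simps embed_add embed_update .
next
  case (exec_Pop x s)
  then show ?case
    using exec.exec_Pop[of "N + x" "embed N s0 s"]
    unfolding shift.simps embed_add embed_update .
next
  case (exec_Branch s x c c1 c0 t s')
  then show ?case
    by (auto intro!: exec.exec_Branch split: list.splits)
qed (auto intro: exec.intros simp del: One_nat_def)

text \<open>Only \<open>Push\<close> and \<open>Pop\<close> write, so registers that are merely
  tested are left out: this bounds the registers that a program can change.\<close>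

primrec regs_below :: "prog \<Rightarrow> nat" where
  "regs_below Skip = 0"
| "regs_below (Push x b) = Suc x"
| "regs_below (Pop x) = Suc x"
| "regs_below (Seq c d) = max (regs_below c) (regs_below d)"
| "regs_below (Branch x c c0 c1) = max (regs_below c) (max (regs_below c0) (regs_below c1))"
| "regs_below (While x c) = regs_below c"

lemma exec_unchanged: "exec c s t s' \<Longrightarrow> regs_below c \<le> r \<Longrightarrow> s' r = s r"
  by (induction rule: exec.induct) (auto split: list.splits if_splits)

text \<open>A step pushes at most one bit.\<close>

lemma exec_length: "exec c s t s' \<Longrightarrow> length (s' r) \<le> length (s r) + t"
  by (induction rule: exec.induct) auto

lemma load_embed: "load (xs @ ys) = embed (length xs) (load xs) (load ys)"
  by (rule ext) (auto simp: load_def embed_def nth_append)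

lemma poly_nat_mono: "x \<le> y \<Longrightarrow> poly (p :: nat poly) x \<le> poly p y"
  by (induction p) (auto intro!: add_mono mult_mono)

lemma length_nth_le_sum_list: "i < length xs \<Longrightarrow> length (xs ! i) \<le> sum_list (map length xs)"
  by (intro member_le_sum_list) auto

text \<open>Calling convention: the arguments at the end of the caller's list are replaced by the
  result, and \<open>p\<close> is the same for all offsets. The program may leave garbage behind, so
  every other register that it can change or that held an argument is erased.\<close>

lemma poly_time_subroutine:
  assumes "poly_time I inp (\<lambda>i. [f i])" and len: "\<And>i. i \<in> I \<Longrightarrow> length (inp i) = m"
  obtains C p where "\<And>i xs. i \<in> I \<Longrightarrow>
    runs (C (length xs)) (load (xs @ inp i)) (poly p (sum_list (map length (inp i))))
      (load (xs @ [f i]))"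
proof -
  obtain c p k where run: "\<And>i. i \<in> I \<Longrightarrow> \<exists>t s. exec c (load (inp i)) t s \<and>
      t \<le> poly p (sum_list (map length (inp i))) \<and> [f i] = map s [0..<k]"
    using assms(1) unfolding poly_time_def by blast
  \<comment> \<open>From \<open>M\<close> on, a register neither holds an argument nor is written
    to, so it is empty after the run.\<close>
  define M where "M = max (regs_below c) m"
  \<comment> \<open>Clearing starts at \<open>N + 1\<close> because register \<open>N\<close> holds
    the result.\<close>
  define C where "C N = Seq (shift N c) (clears [N + 1..<N + 1 + M])" for N
  \<comment> \<open>No register is longer at the end than the input length plus the running time,
    which is the polynomial \<open>[:0, 1:] + p\<close>; at most \<open>M\<close> registers of this
    length are cleared.\<close>
  define p' where "p' = p + [:1:] + [:M:] * ([:2:] * ([:0, 1:] + p) + [:1:])"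
  show ?thesis
  proof
    fix i and xs :: "bits list" assume i: "i \<in> I"
    let ?n = "sum_list (map length (inp i))" and ?N = "length xs"
    obtain t s where c: "exec c (load (inp i)) t s" and t: "t \<le> poly p ?n"
      and out: "[f i] = map s [0..<k]"
      using run[OF i] by (elim exE conjE) (rule that)
    have "length (map s [0..<k]) = 1"
      by (simp flip: out)
    then have "k = 1"
      by simp
    then have s0: "s 0 = f i"
      using out by simp
    have "length (load (inp i) r) \<le> ?n" for r
      by (simp add: load_def length_nth_le_sum_list)
    then have len_s: "length (s r) \<le> ?n + poly p ?n" for r
      using exec_length[OF c, of r] t by (meson add_mono order_trans)
    have s_Nil: "s r = []" if "M \<le> r" for r
      using exec_unchanged[OF c, of r] that len[OF i] by (simp add: M_def load_def)
    let ?S = "embed ?N (load xs) s"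
    have run_c: "runs (shift ?N c) (load (xs @ inp i)) (poly p ?n) ?S"
      unfolding runs_def load_embed using exec_shift[OF c] t by blast
    have clean: "(\<lambda>r. if r \<in> set [?N + 1..<?N + 1 + M] then [] else ?S r) = load (xs @ [f i])"
    proof
      fix r
      show "(if r \<in> set [?N + 1..<?N + 1 + M] then [] else ?S r) = load (xs @ [f i]) r"
        using s_Nil[of "r - ?N"] s0 unfolding load_embed by (auto simp: embed_def load_def)
    qed
    have run_clears: "runs (clears [?N + 1..<?N + 1 + M]) ?S
        (1 + length [?N + 1..<?N + 1 + M] * (2 * (?n + poly p ?n) + 1))
        (load (xs @ [f i]))"
      unfolding clean[symmetric] by (rule runs_clears) (use len_s in \<open>auto simp: embed_def\<close>)
    note runs_Seq[OF run_c run_clears, folded C_def]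
    then show "runs (C ?N) (load (xs @ inp i)) (poly p' ?n) (load (xs @ [f i]))"
      by (rule runs_mono) (simp add: p'_def algebra_simps)
  qed
qed

text \<open>With \<open>k = 1\<close>, only register 0 is read off, so the other registers may end
  with arbitrary contents.\<close>

lemma poly_timeI:
  assumes "\<And>i. i \<in> I \<Longrightarrow>
    \<exists>s. runs c (load (inp i)) (poly p (sum_list (map length (inp i)))) s \<and> s 0 = f i"
  shows "poly_time I inp (\<lambda>i. [f i])"
  unfolding poly_time_def
proof (rule exI[of _ c], rule exI[of _ p], rule exI[of _ 1], rule ballI)
  fix i assume "i \<in> I"
  then obtain s where "runs c (load (inp i)) (poly p (sum_list (map length (inp i)))) s" "s 0 = f i"
    using assms by blast
  then show "\<exists>t s. exec c (load (inp i)) t s \<and> t \<le> poly p (sum_list (map length (inp i))) \<and>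
      [f i] = map s [0..<1]"
    unfolding runs_def by fastforce
qed

text \<open>Outputs sit in consecutive registers, so the same program works with only the first
  \<open>min n k\<close> of them read off.\<close>

lemma poly_time_take:
  assumes "poly_time I inp f"
  shows "poly_time I inp (\<lambda>i. take n (f i))"
proof -
  obtain c p k where run: "\<And>i. i \<in> I \<Longrightarrow> \<exists>t s. exec c (load (inp i)) t s \<and>
      t \<le> poly p (sum_list (map length (inp i))) \<and> f i = map s [0..<k]"
    using assms unfolding poly_time_def by blast
  show ?thesis
    unfolding poly_time_def
  proof (rule exI[of _ c], rule exI[of _ p], rule exI[of _ "min n k"], rule ballI)
    fix i assume "i \<in> I"
    then obtain t s where "exec c (load (inp i)) t s" "t \<le> poly p (sum_list (map length (inp i)))"
      and "f i = map s [0..<k]"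
      using run by blast
    moreover from this have "take n (f i) = map s [0..<min n k]"
      by (simp add: take_map min_def take_upt)
    ultimately show "\<exists>t s. exec c (load (inp i)) t s \<and>
        t \<le> poly p (sum_list (map length (inp i))) \<and> take n (f i) = map s [0..<min n k]"
      by blast
  qed
qed

text \<open>The truncated algorithm uses the same random tape. This serves to cut an adversary's
  output down to its two basenames.\<close>

lemma ppt_take:
  assumes "ppt A"
  shows "ppt (\<lambda>\<eta>. map_pmf (take n) (A \<eta>))"
proof -
  obtain l f where "poly_time {(\<eta>, r). length r = poly l \<eta>} (\<lambda>(\<eta>, r). [unary \<eta>, r]) f"
    and A: "\<And>\<eta>. A \<eta> = map_pmf (\<lambda>r. f (\<eta>, r)) (pmf_of_set {r. length r = poly l \<eta>})"
    using assms unfolding ppt_def by blast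
  then have "poly_time {(\<eta>, r). length r = poly l \<eta>} (\<lambda>(\<eta>, r). [unary \<eta>, r]) (\<lambda>i. take n (f i))"
    by (intro poly_time_take)
  then show ?thesis
    unfolding ppt_def A
    by (intro exI[of _ l] exI[of _ "\<lambda>i. take n (f i)"]) (simp add: pmf.map_comp o_def)
qed

lemma negligible_fun_mono:
  assumes "negligible_fun g" "\<And>\<eta>. \<bar>f \<eta>\<bar> \<le> \<bar>g \<eta>\<bar>"
  shows "negligible_fun f"
  unfolding negligible_fun_def
proof
  fix d
  have "\<forall>\<^sub>F \<eta> in sequentially. \<bar>g \<eta>\<bar> < 1 / real \<eta> ^ d"
    using assms(1) by (simp add: negligible_fun_def)
  then show "\<forall>\<^sub>F \<eta> in sequentially. \<bar>f \<eta>\<bar> < 1 / real \<eta> ^ d"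
    by eventually_elim (use assms(2) order_le_less_trans in blast)
qed

section \<open>Comparison\<close>

text \<open>Register \<open>d\<close> is a flag that is nonempty once a mismatch has been seen,
  including the case that \<open>b\<close> runs out first.\<close>

definition compare_step :: "nat \<Rightarrow> nat \<Rightarrow> nat \<Rightarrow> prog" where
  "compare_step a b d =
     Seq (Branch a Skip (Branch b (Push d True) Skip (Push d True))
            (Branch b (Push d True) (Push d True) Skip))
         (Seq (Pop a) (Pop b))"

lemma runs_compare_step:
  assumes "distinct [a, b, d]" "s a = v # vs"
  shows "runs (compare_step a b d) s 5
    (s(a := vs, b := tl (s b),
       d := (if s b \<noteq> [] \<and> hd (s b) = v then s d else True # s d)))"
proof -
  let ?D = "if s b \<noteq> [] \<and> hd (s b) = v then s d else True # s d"
  have "runs (Branch a Skip (Branch b (Push d True) Skip (Push d True))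
            (Branch b (Push d True) (Push d True) Skip)) s (Suc (Suc 1)) (s(d := ?D))"
    using assms runs_Push[of d True s] runs_Skip[of s]
    by (intro runs_Branch, cases v) (auto intro!: runs_Branch split: list.split)
  moreover have "runs (Pop a) (s(d := ?D)) 1 (s(d := ?D, a := vs))"
    using runs_Pop[of a "s(d := ?D)"] assms by simp
  moreover have "runs (Pop b) (s(d := ?D, a := vs)) 1 (s(d := ?D, a := vs, b := tl (s b)))"
    using runs_Pop[of b "s(d := ?D, a := vs)"] assms by simp
  ultimately have "runs (compare_step a b d) s (Suc (Suc 1) + (1 + 1))
      (s(d := ?D, a := vs, b := tl (s b)))"
    unfolding compare_step_def by (intro runs_Seq)
  moreover have "s(d := ?D, a := vs, b := tl (s b)) = s(a := vs, b := tl (s b), d := ?D)"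
    by (rule ext) (use assms in simp)
  ultimately have "runs (compare_step a b d) s (Suc (Suc 1) + (1 + 1))
      (s(a := vs, b := tl (s b), d := ?D))"
    by (simp only:)
  then show ?thesis
    by (rule runs_mono) simp
qed

text \<open>The loop ends when \<open>a\<close> is exhausted. If \<open>b\<close> is longer, a rest
  of it remains; if it is shorter or differs in some bit, the flag \<open>d\<close> is set. The
  induction needs an arbitrary initial flag.\<close>

lemma runs_compare_loop:
  assumes "distinct [a, b, d]"
  shows "\<exists>s'. runs (While a (compare_step a b d)) s (6 * length (s a) + 1) s' \<and>
    (s' b = [] \<and> s' d = [] \<longleftrightarrow> s a = s b \<and> s d = []) \<and>
    (\<forall>r. r \<notin> {a, b, d} \<longrightarrow> s' r = s r)"
proof (induction "s a" arbitrary: s)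
  case Nil
  note sa = Nil[symmetric]
  show ?case
    using runs_While_done[of s a, OF sa, of "compare_step a b d"]
    by (intro exI[of _ s]) (auto simp: sa)
next
  case (Cons v vs)
  note sa = Cons.hyps(2)[symmetric]
  let ?s = "s(a := vs, b := tl (s b),
      d := (if s b \<noteq> [] \<and> hd (s b) = v then s d else True # s d))"
  obtain s' where s': "runs (While a (compare_step a b d)) ?s (6 * length vs + 1) s'"
    "s' b = [] \<and> s' d = [] \<longleftrightarrow> vs = tl (s b) \<and> ?s d = []"
    "\<forall>r. r \<notin> {a, b, d} \<longrightarrow> s' r = ?s r"
    using Cons.hyps(1)[of ?s] assms by auto
  have "runs (While a (compare_step a b d)) s (Suc (5 + (6 * length vs + 1))) s'"
    by (rule runs_While_step[OF _ runs_compare_step[of a b d s v vs, OF assms sa] s'(1)])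
      (simp add: sa)
  moreover have "s' b = [] \<and> s' d = [] \<longleftrightarrow> s a = s b \<and> s d = []"
    \<comment> \<open>If \<open>b\<close> is empty, the flag has just been set and both sides are
      false; otherwise the first bits decide whether it is set.\<close>
    unfolding s'(2) sa using assms by (cases "s b") auto
  moreover have "\<forall>r. r \<notin> {a, b, d} \<longrightarrow> s' r = s r"
    using s'(3) by simp
  ultimately show ?case
    by (intro exI[of _ s']) (simp add: sa)
qed

definition compare :: "nat \<Rightarrow> nat \<Rightarrow> nat \<Rightarrow> nat \<Rightarrow> prog" where
  "compare a b d r =
     Seq (While a (compare_step a b d))
    (Seq (clear r)
         (Branch b (Branch d (Push r True) (Push r False) (Push r False))
           (Push r False) (Push r False)))"

lemma runs_compare:
  assumes "distinct [a, b, d, r]" "s d = []"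
  shows "\<exists>s'. runs (compare a b d r) s (6 * length (s a) + 2 * length (s r) + 5) s' \<and>
    s' r = [s a = s b]"
proof -
  obtain s1 where s1: "runs (While a (compare_step a b d)) s (6 * length (s a) + 1) s1"
    "s1 b = [] \<and> s1 d = [] \<longleftrightarrow> s a = s b" "\<forall>r. r \<notin> {a, b, d} \<longrightarrow> s1 r = s r"
    using runs_compare_loop[of a b d s] assms by auto
  then have s1_r: "s1 r = s r"
    using assms by auto
  let ?s2 = "s1(r := [])"
  have "runs (clear r) s1 (2 * length (s r) + 1) ?s2"
    using runs_clear[of r s1] s1_r by simp
  moreover have "runs (Branch b (Branch d (Push r True) (Push r False) (Push r False))
           (Push r False) (Push r False)) ?s2 (Suc (Suc 1)) (?s2(r := [s a = s b]))"
  proof (cases "s1 b = []")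
    case True
    have "runs (Branch d (Push r True) (Push r False) (Push r False)) ?s2 (Suc 1)
        (?s2(r := [s a = s b]))"
      using assms s1(2) True runs_Push[of r True ?s2] runs_Push[of r False ?s2]
      by (intro runs_Branch) (auto split: list.split)
    then show ?thesis
      using True assms by (intro runs_Branch) simp
  next
    case False
    then have "runs (Push r False) ?s2 (Suc 1) (?s2(r := [s a = s b]))"
      using s1(2) runs_mono[OF runs_Push[of r False ?s2], of "Suc 1"] by simp
    then show ?thesis
      using False assms by (intro runs_Branch) (auto split: list.split)
  qed
  ultimately have "runs (compare a b d r) s
      ((6 * length (s a) + 1) + ((2 * length (s r) + 1) + Suc (Suc 1))) (?s2(r := [s a = s b]))"
    unfolding compare_def using s1(1) by (intro runs_Seq)
  then have "runs (compare a b d r) s (6 * length (s a) + 2 * length (s r) + 5)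
      (?s2(r := [s a = s b]))"
    by (rule runs_mono) simp
  then show ?thesis
    by (rule_tac x = "?s2(r := [s a = s b])" in exI) simp
qed

lemma list_update_Cons_numeral:
  "(x # xs)[numeral v := y] = x # xs[pred_numeral v := y]"
  by (simp add: numeral_eq_Suc)

section \<open>Exponentiation\<close>

text \<open>
  Registers: 0 security parameter, 1 exponent, 2 basename, 3 base, 4 remaining bits of the exponent
  with the most significant bit first, 5 accumulator, 6 scratch space for \<open>assign\<close>, from 7 on
  arguments and result of subroutines.
\<close>

definition mult_acc :: "(nat \<Rightarrow> prog) \<Rightarrow> nat \<Rightarrow> prog" where
  "mult_acc C y = Seq (assign 6 7 0) (Seq (assign 6 8 5) (Seq (assign 6 9 y)
     (Seq (C 7) (assign 6 5 7))))"

text \<open>Factor register 5 squares the accumulator; factor register 3 multiplies it by the base,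
  for a bit 1 only.\<close>

definition power_loop :: "(nat \<Rightarrow> prog) \<Rightarrow> prog" where
  "power_loop C =
     While 4 (Seq (mult_acc C 5) (Seq (Branch 4 Skip Skip (mult_acc C 3)) (Pop 4)))"

text \<open>Four assignments of cost \<open>11 * B + 3\<close> surround one call of cost
  \<open>W\<close>. The contents \<open>v\<close> of register 7 may stem from an earlier call and
  are overwritten first.\<close>

lemma runs_mult_acc:
  fixes G (structure)
  assumes C: "\<And>xs x y. x \<in> carrier G \<Longrightarrow> y \<in> carrier G \<Longrightarrow>
      runs (C (length xs)) (load (xs @ [u, x, y])) W (load (xs @ [x \<otimes> y]))"
    and B: "length u \<le> B" "\<And>x. x \<in> carrier G \<Longrightarrow> length x \<le> B" "length v \<le> B"
    and G: "monoid G" "j \<in> carrier G" "acc \<in> carrier G"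
    and y: "y = 3 \<and> z = j \<or> y = 5 \<and> z = acc"
  shows "runs (mult_acc C y) (load [u, k, d, j, rb, acc, [], v, [], []]) (44 * B + 12 + W)
    (load [u, k, d, j, rb, acc \<otimes> z, [], acc \<otimes> z, [], []])"
proof -
  interpret monoid G by fact
  note list_simps = list_update_Cons_numeral load_nth
  have z: "z \<in> carrier G" "acc \<otimes> z \<in> carrier G"
    using y G by auto
  have 1: "runs (assign 6 7 0) (load [u, k, d, j, rb, acc, [], v, [], []]) (11 * B + 3)
      (load [u, k, d, j, rb, acc, [], u, [], []])"
    using runs_assign[of 6 0 7 "[u, k, d, j, rb, acc, [], v, [], []]" B] B
    by (simp add: list_simps)
  have 2: "runs (assign 6 8 5) (load [u, k, d, j, rb, acc, [], u, [], []]) (11 * B + 3)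
      (load [u, k, d, j, rb, acc, [], u, acc, []])"
    using runs_assign[of 6 5 8 "[u, k, d, j, rb, acc, [], u, [], []]" B] B G
    by (simp add: list_simps)
  have 3: "runs (assign 6 9 y) (load [u, k, d, j, rb, acc, [], u, acc, []]) (11 * B + 3)
      (load [u, k, d, j, rb, acc, [], u, acc, z])"
    using runs_assign[of 6 y 9 "[u, k, d, j, rb, acc, [], u, acc, []]" B] y B G
    by (auto simp add: list_simps)
  \<comment> \<open>The caller keeps seven registers. The call turns three arguments into one
    result, and two empty registers restore the length ten.\<close>
  have 4: "runs (C 7) (load [u, k, d, j, rb, acc, [], u, acc, z]) W
      (load [u, k, d, j, rb, acc, [], acc \<otimes> z, [], []])"
    using C[of acc z "[u, k, d, j, rb, acc, []]"] G z
      load_append_Nils[of "[u, k, d, j, rb, acc, [], acc \<otimes> z]" 2]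
    by (simp add: numeral_eq_Suc)
  have 5: "runs (assign 6 5 7) (load [u, k, d, j, rb, acc, [], acc \<otimes> z, [], []]) (11 * B + 3)
      (load [u, k, d, j, rb, acc \<otimes> z, [], acc \<otimes> z, [], []])"
    using runs_assign[of 6 7 5 "[u, k, d, j, rb, acc, [], acc \<otimes> z, [], []]" B] B G z
    by (simp add: list_simps)
  show ?thesis
    unfolding mult_acc_def
    by (rule runs_mono[OF runs_Seq[OF 1 runs_Seq[OF 2 runs_Seq[OF 3 runs_Seq[OF 4 5]]]]]) simp
qed

text \<open>Invariant: the accumulator is \<open>j [^] e\<close>, where \<open>e\<close> is the
  number read so far; the fold is Horner's rule. A round costs at most two multiplications plus 4
  steps for loop test, branch, \<open>Pop\<close> and a possible \<open>Skip\<close>.\<close>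

lemma runs_power_loop:
  fixes G (structure)
  assumes C: "\<And>xs x y. x \<in> carrier G \<Longrightarrow> y \<in> carrier G \<Longrightarrow>
      runs (C (length xs)) (load (xs @ [u, x, y])) W (load (xs @ [x \<otimes> y]))"
    and B: "length u \<le> B" "\<And>x. x \<in> carrier G \<Longrightarrow> length x \<le> B"
    and G: "monoid G" "j \<in> carrier G"
    and v: "length v \<le> B"
  shows "\<exists>v'. runs (power_loop C) (load [u, k, d, j, bs, j [^] (e::nat), [], v, [], []])
      (length bs * (2 * (44 * B + 12 + W) + 4) + 1)
      (load [u, k, d, j, [], j [^] foldl (\<lambda>e b. 2 * e + of_bool b) e bs, [], v', [], []])"
  using v
proof (induction bs arbitrary: e v)
  case Nil
  have "load [u, k, d, j, [], j [^] e, [], v, [], []] 4 = []"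
    by (simp add: load_nth)
  then show ?case
    unfolding power_loop_def using runs_While_done by fastforce
next
  case (Cons b bs)
  interpret monoid G by fact
  note list_simps = list_update_Cons_numeral load_nth load_update
  define W' where "W' = 44 * B + 12 + W"
  define e' where "e' = 2 * e + of_bool b"
  let ?r = "\<lambda>rb acc v. load [u, k, d, j, rb, acc, [], v, [], []]"
  have sq: "j [^] e \<otimes> j [^] e = j [^] (2 * e)"
    using G by (simp add: nat_pow_mult mult_2)
  have 1: "runs (mult_acc C 5) (?r (b # bs) (j [^] e) v) W'
      (?r (b # bs) (j [^] (2 * e)) (j [^] (2 * e)))"
    using runs_mult_acc[OF C B(1,2) Cons.prems G, of "j [^] e" 5 "j [^] e" k d "b # bs"] G
    by (simp add: sq W'_def)
  have 2: "runs (Branch 4 Skip Skip (mult_acc C 3)) (?r (b # bs) (j [^] (2 * e)) (j [^] (2 * e)))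
      (Suc (W' + 1)) (?r (b # bs) (j [^] e') (j [^] e'))"
  proof (rule runs_Branch)
    have "runs (mult_acc C 3) (?r (b # bs) (j [^] (2 * e)) (j [^] (2 * e))) W'
        (?r (b # bs) (j [^] e') (j [^] e'))" if b
      using runs_mult_acc[OF C B(1,2) _ G, of "j [^] (2 * e)" "j [^] (2 * e)" 3 j k d "b # bs"] G B that
      by (simp add: W'_def e'_def)
    then have "runs (if b then mult_acc C 3 else Skip) (?r (b # bs) (j [^] (2 * e)) (j [^] (2 * e)))
        (W' + 1) (?r (b # bs) (j [^] e') (j [^] e'))"
      using runs_mono[OF runs_Skip, of "W' + 1"] runs_mono[of _ _ W' _ "W' + 1"]
      by (simp add: e'_def)
    then show "runs (case ?r (b # bs) (j [^] (2 * e)) (j [^] (2 * e)) 4 of [] \<Rightarrow> Skip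
        | b # _ \<Rightarrow> if b then mult_acc C 3 else Skip)
        (?r (b # bs) (j [^] (2 * e)) (j [^] (2 * e))) (W' + 1) (?r (b # bs) (j [^] e') (j [^] e'))"
      by (simp add: load_nth)
  qed
  have 3: "runs (Pop 4) (?r (b # bs) (j [^] e') (j [^] e')) 1 (?r bs (j [^] e') (j [^] e'))"
    using runs_Pop[of 4 "?r (b # bs) (j [^] e') (j [^] e')"] by (simp add: list_simps)
  have "length (j [^] e') \<le> B"
    using B G by simp
  from Cons.IH[OF this, of e'] obtain v' where
    4: "runs (power_loop C) (?r bs (j [^] e') (j [^] e')) (length bs * (2 * W' + 4) + 1)
      (?r [] (j [^] foldl (\<lambda>e b. 2 * e + of_bool b) e' bs) v')"
    unfolding W'_def by blast
  have "?r (b # bs) (j [^] e) v 4 \<noteq> []"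
    by (simp add: load_nth)
  note step = runs_While_step[OF this runs_Seq[OF 1 runs_Seq[OF 2 3]] 4[unfolded power_loop_def]]
  have "runs (power_loop C) (?r (b # bs) (j [^] e) v) (length (b # bs) * (2 * W' + 4) + 1)
      (?r [] (j [^] foldl (\<lambda>e b. 2 * e + of_bool b) e (b # bs)) v')"
    unfolding power_loop_def foldl_Cons e'_def[symmetric]
    by (rule runs_mono[OF step]) simp
  then show ?case
    unfolding W'_def by blast
qed

lemma foldl_rev_bin: "foldl (\<lambda>e b. 2 * e + of_bool b) 0 (rev (bin n)) = n"
proof (induction n rule: bin.induct)
  case (1 n)
  then show ?case
    by (subst bin.simps) (auto simp: mod2_eq_if)
qed

text \<open>The most significant bit of a positive number is 1, which allows the accumulator to
  start with the base.\<close>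

lemma rev_bin: "0 < n \<Longrightarrow> \<exists>bs. rev (bin n) = True # bs"
proof (induction n rule: bin.induct)
  case (1 n)
  show ?case
  proof (cases "n = 1")
    case False
    then show ?thesis
      using 1 by (subst bin.simps) auto
  qed (simp add: bin.simps)
qed

text \<open>The hash value becomes both base and accumulator. \<open>move_rev\<close> brings the
  exponent into most-significant-first order, and \<open>Pop\<close> drops its leading 1, already
  accounted for by the accumulator.\<close>

definition power_hash :: "(nat \<Rightarrow> prog) \<Rightarrow> (nat \<Rightarrow> prog) \<Rightarrow> prog" where
  "power_hash Ch C = Seq (assign 6 7 0) (Seq (assign 6 8 2) (Seq (Ch 7) (Seq (assign 6 3 7)
     (Seq (assign 6 5 7) (Seq (move_rev 1 4) (Seq (Pop 4) (Seq (power_loop C) (assign 6 0 5))))))))"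

text \<open>All intermediate powers lie in the carrier, so their lengths, and hence the cost of
  every multiplication, stay polynomially bounded; the number of rounds is below the length of the
  exponent.\<close>

lemma poly_time_power_hash:
  fixes G :: "nat \<Rightarrow> bits monoid" and h :: "nat \<Rightarrow> bits \<Rightarrow> bits"
  assumes monoid: "\<And>\<eta>. monoid (G \<eta>)" and G: "efficient_group G"
    and h: "\<And>\<eta> x. h \<eta> x \<in> carrier (G \<eta>)"
    and time_h: "poly_time UNIV (\<lambda>(\<eta>, x). [unary \<eta>, x]) (\<lambda>(\<eta>, x). [h \<eta> x])"
  shows "poly_time {(\<eta>, f, bsn). 0 < f} (\<lambda>(\<eta>, f, bsn). [unary \<eta>, bin f, bsn])
    (\<lambda>(\<eta>, f, bsn). [h \<eta> bsn [^]\<^bsub>G \<eta>\<^esub> f])"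
proof -
  obtain L :: "nat poly" where L: "\<And>\<eta> x. x \<in> carrier (G \<eta>) \<Longrightarrow> length x \<le> poly L \<eta>"
    using G unfolding efficient_group_def by blast
  have "poly_time {(\<eta>, x, y). x \<in> carrier (G \<eta>) \<and> y \<in> carrier (G \<eta>)}
       (\<lambda>(\<eta>, x, y). [unary \<eta>, x, y]) (\<lambda>i. [case i of (\<eta>, x, y) \<Rightarrow> x \<otimes>\<^bsub>G \<eta>\<^esub> y])"
    using G unfolding efficient_group_def by (simp add: case_prod_unfold)
  then obtain C p where C: "\<And>i xs. i \<in> {(\<eta>, x, y). x \<in> carrier (G \<eta>) \<and> y \<in> carrier (G \<eta>)} \<Longrightarrow>
      runs (C (length xs)) (load (xs @ (case i of (\<eta>, x, y) \<Rightarrow> [unary \<eta>, x, y])))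
        (poly p (sum_list (map length (case i of (\<eta>, x, y) \<Rightarrow> [unary \<eta>, x, y]))))
        (load (xs @ [case i of (\<eta>, x, y) \<Rightarrow> x \<otimes>\<^bsub>G \<eta>\<^esub> y]))"
    by (rule poly_time_subroutine[of _ _ _ 3]) auto
  have "poly_time UNIV (\<lambda>(\<eta>, x). [unary \<eta>, x]) (\<lambda>i. [case i of (\<eta>, x) \<Rightarrow> h \<eta> x])"
    using time_h by (simp add: case_prod_unfold)
  then obtain Ch ph where Ch: "\<And>i xs. i \<in> UNIV \<Longrightarrow>
      runs (Ch (length xs)) (load (xs @ (case i of (\<eta>, x) \<Rightarrow> [unary \<eta>, x])))
        (poly ph (sum_list (map length (case i of (\<eta>, x) \<Rightarrow> [unary \<eta>, x]))))
        (load (xs @ [case i of (\<eta>, x) \<Rightarrow> h \<eta> x]))"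
    by (rule poly_time_subroutine[of _ _ _ 2]) auto
  \<comment> \<open>Input length plus the length bound of group elements; this bounds every register
    used.\<close>
  define pB where "pB = [:0, 1:] + L"
  \<comment> \<open>Five assignments, one hash evaluation, reversal and \<open>Pop\<close>, then at
    most \<open>pB\<close> rounds of the loop; a multiplication has input length at most
    \<open>3 * pB\<close>.\<close>
  define pT where "pT = [:5:] * ([:11:] * pB + [:3:]) + pcompose ph pB + [:4:] * pB + [:2:] +
      (pB * ([:2:] * ([:44:] * pB + [:12:] + pcompose p ([:3:] * pB)) + [:4:]) + [:1:])"
  have "poly_time {(\<eta>, f, bsn). 0 < f} (\<lambda>(\<eta>, f, bsn). [unary \<eta>, bin f, bsn])
    (\<lambda>i. [case i of (\<eta>, f, bsn) \<Rightarrow> h \<eta> bsn [^]\<^bsub>G \<eta>\<^esub> f])"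
  proof (rule poly_timeI[of _ "power_hash Ch C" _ pT])
    fix i :: "nat \<times> nat \<times> bits"
    assume "i \<in> {(\<eta>, f, bsn). 0 < f}"
    then obtain \<eta> f d where i: "i = (\<eta>, f, d)" and f: "0 < f"
      by auto
    interpret monoid "G \<eta>" by (rule monoid)
    let ?n = "sum_list (map length [unary \<eta>, bin f, d])"
    define u k j where "u = unary \<eta>" and "k = bin f" and "j = h \<eta> d"
    define B where "B = poly pB ?n"
    define W where "W = poly p (3 * B)"
    have B_eq: "B = ?n + poly L ?n"
      by (simp add: B_def pB_def)
    have len: "length u + length k + length d \<le> B" "length u \<le> B" "length k \<le> B" "length d \<le> B"
      by (simp_all add: B_eq u_def k_def)
    \<comment> \<open>The security parameter is given in unary, so a bound in \<open>\<eta>\<close>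
      is also one in the input length.\<close>
    have "\<eta> \<le> ?n"
      by (simp add: unary_def)
    then have LB: "length x \<le> B" if "x \<in> carrier (G \<eta>)" for x
      using L[OF that] poly_nat_mono[of \<eta> ?n L] by (simp add: B_eq)
    have j: "j \<in> carrier (G \<eta>)" "length j \<le> B"
      using h LB by (auto simp: j_def)
    have mult: "runs (C (length xs)) (load (xs @ [u, x, y])) W (load (xs @ [x \<otimes>\<^bsub>G \<eta>\<^esub> y]))"
      if "x \<in> carrier (G \<eta>)" "y \<in> carrier (G \<eta>)" for xs x y
    proof (rule runs_mono)
      show "runs (C (length xs)) (load (xs @ [u, x, y])) (poly p (length u + length x + length y))
          (load (xs @ [x \<otimes>\<^bsub>G \<eta>\<^esub> y]))"
        using C[of "(\<eta>, x, y)" xs] that by (simp add: u_def add.assoc)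
      show "poly p (length u + length x + length y) \<le> W"
        unfolding W_def using len LB[OF that(1)] LB[OF that(2)] by (intro poly_nat_mono) simp
    qed
    obtain bs where bs: "rev k = True # bs"
      using rev_bin[OF f] by (auto simp: k_def)
    have "length bs \<le> B"
      using len(3) arg_cong[OF bs, of length] by simp
    note list_simps = list_update_Cons_numeral load_nth load_update
    have 1: "runs (assign 6 7 0) (load [u, k, d, [], [], [], [], [], [], []]) (11 * B + 3)
        (load [u, k, d, [], [], [], [], u, [], []])"
      using runs_assign[of 6 0 7 "[u, k, d, [], [], [], [], [], [], []]" B] len
      by (simp add: list_simps)
    have 2: "runs (assign 6 8 2) (load [u, k, d, [], [], [], [], u, [], []]) (11 * B + 3)
        (load [u, k, d, [], [], [], [], u, d, []])"
      using runs_assign[of 6 2 8 "[u, k, d, [], [], [], [], u, [], []]" B] len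
      by (simp add: list_simps)
    have 3: "runs (Ch 7) (load [u, k, d, [], [], [], [], u, d, []]) (poly ph B)
        (load [u, k, d, [], [], [], [], j, [], []])"
    proof (rule runs_mono)
      show "runs (Ch 7) (load [u, k, d, [], [], [], [], u, d, []]) (poly ph (length u + length d))
          (load [u, k, d, [], [], [], [], j, [], []])"
        using Ch[of "(\<eta>, d)" "[u, k, d, [], [], [], []]"]
          load_append_Nil[of "[u, k, d, [], [], [], [], u, d]"]
          load_append_Nils[of "[u, k, d, [], [], [], [], j]" 2]
        by (simp add: u_def j_def numeral_eq_Suc)
      show "poly ph (length u + length d) \<le> poly ph B"
        using len by (intro poly_nat_mono) simp
    qed
    have 4: "runs (assign 6 3 7) (load [u, k, d, [], [], [], [], j, [], []]) (11 * B + 3)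
        (load [u, k, d, j, [], [], [], j, [], []])"
      using runs_assign[of 6 7 3 "[u, k, d, [], [], [], [], j, [], []]" B] j
      by (simp add: list_simps)
    have 5: "runs (assign 6 5 7) (load [u, k, d, j, [], [], [], j, [], []]) (11 * B + 3)
        (load [u, k, d, j, [], j, [], j, [], []])"
      using runs_assign[of 6 7 5 "[u, k, d, j, [], [], [], j, [], []]" B] j
      by (simp add: list_simps)
    have 6: "runs (move_rev 1 4) (load [u, k, d, j, [], j, [], j, [], []]) (4 * B + 1)
        (load [u, [], d, j, True # bs, j, [], j, [], []])"
      by (rule runs_mono[of _ _ "4 * length k + 1"])
        (use runs_move_rev[of 1 4 "load [u, k, d, j, [], j, [], j, [], []]"] len bs
          in \<open>simp_all add: list_simps\<close>)
    have 7: "runs (Pop 4) (load [u, [], d, j, True # bs, j, [], j, [], []]) 1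
        (load [u, [], d, j, bs, j, [], j, [], []])"
      using runs_Pop[of 4 "load [u, [], d, j, True # bs, j, [], j, [], []]"]
      by (simp add: list_simps)
    \<comment> \<open>Consuming the leading 1 takes Horner's rule from 0 to 1.\<close>
    have "foldl (\<lambda>e b. 2 * e + of_bool b) 1 bs = f"
      using foldl_rev_bin[of f] bs by (simp add: k_def)
    then obtain v where 8: "runs (power_loop C) (load [u, [], d, j, bs, j, [], j, [], []])
        (length bs * (2 * (44 * B + 12 + W) + 4) + 1)
        (load [u, [], d, j, [], j [^]\<^bsub>G \<eta>\<^esub> f, [], v, [], []])"
      using runs_power_loop[OF mult len(2) LB monoid j, of "[]" d bs 1] j by auto
    have 9: "runs (assign 6 0 5) (load [u, [], d, j, [], j [^]\<^bsub>G \<eta>\<^esub> f, [], v, [], []])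
        (11 * B + 3)
        (load [j [^]\<^bsub>G \<eta>\<^esub> f, [], d, j, [], j [^]\<^bsub>G \<eta>\<^esub> f, [], v, [], []])"
      using runs_assign[of 6 5 0 "[u, [], d, j, [], j [^]\<^bsub>G \<eta>\<^esub> f, [], v, [], []]" B] len j LB
      by (simp add: list_simps)
    have "runs (power_hash Ch C) (load [u, k, d, [], [], [], [], [], [], []]) (poly pT ?n)
        (load [j [^]\<^bsub>G \<eta>\<^esub> f, [], d, j, [], j [^]\<^bsub>G \<eta>\<^esub> f, [], v, [], []])"
      unfolding power_hash_def
    proof (rule runs_mono[OF runs_Seq[OF 1 runs_Seq[OF 2 runs_Seq[OF 3 runs_Seq[OF 4
            runs_Seq[OF 5 runs_Seq[OF 6 runs_Seq[OF 7 runs_Seq[OF 8 9]]]]]]]]])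
      \<comment> \<open>Naming the nonlinear products leaves a linear inequality.\<close>
      define X Y where "X = length bs * (2 * (44 * B + 12 + W) + 4)"
        and "Y = B * (2 * (44 * B + 12 + W) + 4)"
      have "X \<le> Y"
        unfolding X_def Y_def using \<open>length bs \<le> B\<close> by (rule mult_le_mono1)
      moreover have "poly pT ?n = 5 * (11 * B + 3) + poly ph B + 4 * B + 2 + (Y + 1)"
        unfolding Y_def
        by (simp only: pT_def B_def W_def poly_add poly_mult poly_pcompose poly_pCons poly_0) simp
      ultimately show "11 * B + 3 + (11 * B + 3 + (poly ph B + (11 * B + 3 + (11 * B + 3 +
          (4 * B + 1 + (1 + (length bs * (2 * (44 * B + 12 + W) + 4) + 1 + (11 * B + 3)))))))) \<le>
          poly pT ?n"
        unfolding X_def[symmetric] by presburger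
    qed
    moreover have "load [u, k, d, [], [], [], [], [], [], []] = load [unary \<eta>, bin f, d]"
      using load_append_Nils[of "[u, k, d]" 7] by (simp add: u_def k_def numeral_eq_Suc)
    moreover have "load [j [^]\<^bsub>G \<eta>\<^esub> f, [], d, j, [], j [^]\<^bsub>G \<eta>\<^esub> f, [], v, [], []] 0 =
        h \<eta> d [^]\<^bsub>G \<eta>\<^esub> f"
      by (simp add: load_nth j_def)
    ultimately show "\<exists>s. runs (power_hash Ch C)
        (load (case i of (\<eta>, f, bsn) \<Rightarrow> [unary \<eta>, bin f, bsn]))
        (poly pT (sum_list (map length (case i of (\<eta>, f, bsn) \<Rightarrow> [unary \<eta>, bin f, bsn])))) s \<and>
        s 0 = (case i of (\<eta>, f, bsn) \<Rightarrow> h \<eta> bsn [^]\<^bsub>G \<eta>\<^esub> f)"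
      unfolding i prod.case by metis
  qed
  then show ?thesis
    by (simp add: case_prod_unfold)
qed

section \<open>Instant linkability\<close>

text \<open>Splitting off the first component of a signature leaves eight others in
  \<open>e\<close>, so \<open>J\<close> is in register 1, the basename in register 10, and register
  11 is the first free one.\<close>

lemma poly_time_eq_hash:
  fixes e :: "'s \<Rightarrow> bits list"
  assumes time_h: "poly_time UNIV (\<lambda>(\<eta>, x). [unary \<eta>, x]) (\<lambda>(\<eta>, x). [h \<eta> x])"
    and len: "\<And>\<sigma>. length (e \<sigma>) = 8"
  shows "poly_time UNIV (\<lambda>(\<eta>, \<sigma>, bsn). [unary \<eta>, J \<sigma>] @ e \<sigma> @ [bsn])
    (\<lambda>(\<eta>, \<sigma>, bsn). [[J \<sigma> = h \<eta> bsn]])"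
proof -
  have "poly_time UNIV (\<lambda>(\<eta>, x). [unary \<eta>, x]) (\<lambda>i. [case i of (\<eta>, x) \<Rightarrow> h \<eta> x])"
    using time_h by (simp add: case_prod_unfold)
  then obtain Ch ph where Ch: "\<And>i xs. i \<in> UNIV \<Longrightarrow>
      runs (Ch (length xs)) (load (xs @ (case i of (\<eta>, x) \<Rightarrow> [unary \<eta>, x])))
        (poly ph (sum_list (map length (case i of (\<eta>, x) \<Rightarrow> [unary \<eta>, x]))))
        (load (xs @ [case i of (\<eta>, x) \<Rightarrow> h \<eta> x]))"
    by (rule poly_time_subroutine[of _ _ _ 2]) auto
  define p where "p = [:30:] * [:0, 1:] + [:11:] + ph"
  \<comment> \<open>Register 11 is scratch space for \<open>assign\<close> and, being empty again,
    the mismatch flag of \<open>compare\<close>. The answer overwrites the security parameter, which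
    has been copied before.\<close>
  define c where "c = Seq (assign 11 12 0) (Seq (assign 11 13 10) (Seq (Ch 12) (compare 1 12 11 0)))"
  have "poly_time UNIV (\<lambda>(\<eta>, \<sigma>, bsn). [unary \<eta>, J \<sigma>] @ e \<sigma> @ [bsn])
    (\<lambda>i. [case i of (\<eta>, \<sigma>, bsn) \<Rightarrow> [J \<sigma> = h \<eta> bsn]])"
  proof (rule poly_timeI[of _ c _ p])
    fix i :: "nat \<times> 's \<times> bits"
    obtain \<eta> \<sigma> d where i: "i = (\<eta>, \<sigma>, d)"
      by (cases i)
    let ?n = "sum_list (map length ([unary \<eta>, J \<sigma>] @ e \<sigma> @ [d]))"
    define B where "B = ?n"
    define xs where "xs = [unary \<eta>, J \<sigma>] @ e \<sigma> @ [d, []]"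
    have xs: "length xs = 12" "xs ! 0 = unary \<eta>" "xs ! 1 = J \<sigma>" "xs ! 10 = d" "xs ! 11 = []"
      by (simp_all add: xs_def len nth_append numeral_eq_Suc)
    have B: "length (unary \<eta>) + length d \<le> B" "length (unary \<eta>) \<le> B" "length d \<le> B"
      "length (J \<sigma>) \<le> B"
      by (simp_all add: B_def)
    have 1: "runs (assign 11 12 0) (load (xs @ [[], []])) (11 * B + 3)
        (load (xs @ [unary \<eta>, []]))"
      using runs_assign[of 11 0 12 "xs @ [[], []]" B] xs B
      by (simp add: nth_append list_update_append)
    have 2: "runs (assign 11 13 10) (load (xs @ [unary \<eta>, []])) (11 * B + 3)
        (load (xs @ [unary \<eta>, d]))"
      using runs_assign[of 11 10 13 "xs @ [unary \<eta>, []]" B] xs B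
      by (simp add: nth_append list_update_append)
    have 3: "runs (Ch 12) (load (xs @ [unary \<eta>, d])) (poly ph B) (load (xs @ [h \<eta> d]))"
    proof (rule runs_mono)
      show "runs (Ch 12) (load (xs @ [unary \<eta>, d])) (poly ph (length (unary \<eta>) + length d))
          (load (xs @ [h \<eta> d]))"
        using Ch[of "(\<eta>, d)" xs] xs(1) by simp
      show "poly ph (length (unary \<eta>) + length d) \<le> poly ph B"
        using B by (intro poly_nat_mono) simp
    qed
    let ?s = "load (xs @ [h \<eta> d])"
    have s: "?s 0 = unary \<eta>" "?s 1 = J \<sigma>" "?s 11 = []" "?s 12 = h \<eta> d"
      using xs by (simp_all add: load_nth nth_append)
    obtain s' where 4: "runs (compare 1 12 11 0) ?s (6 * length (J \<sigma>) + 2 * length (unary \<eta>) + 5) s'"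
      and s': "s' 0 = [J \<sigma> = h \<eta> d]"
      using runs_compare[of 1 12 11 0 ?s] unfolding s by auto
    have "runs c (load (xs @ [[], []])) (poly p ?n) s'"
      unfolding c_def
    proof (rule runs_mono[OF runs_Seq[OF 1 runs_Seq[OF 2 runs_Seq[OF 3 4]]]])
      have "poly p ?n = 30 * B + 11 + poly ph B"
        by (simp only: p_def B_def poly_add poly_mult poly_pCons poly_0) simp
      then show "11 * B + 3 + (11 * B + 3 + (poly ph B +
          (6 * length (J \<sigma>) + 2 * length (unary \<eta>) + 5))) \<le> poly p ?n"
        using B by linarith
    qed
    moreover have "load (xs @ [[], []]) = load ([unary \<eta>, J \<sigma>] @ e \<sigma> @ [d])"
      using load_append_Nils[of "[unary \<eta>, J \<sigma>] @ e \<sigma> @ [d]" 3]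
      by (simp add: xs_def numeral_eq_Suc)
    ultimately show "\<exists>s. runs c (load (case i of (\<eta>, \<sigma>, bsn) \<Rightarrow> [unary \<eta>, J \<sigma>] @ e \<sigma> @ [bsn]))
        (poly p (sum_list (map length
          (case i of (\<eta>, \<sigma>, bsn) \<Rightarrow> [unary \<eta>, J \<sigma>] @ e \<sigma> @ [bsn])))) s \<and>
        s 0 = (case i of (\<eta>, \<sigma>, bsn) \<Rightarrow> [J \<sigma> = h \<eta> bsn])"
      unfolding i prod.case using s' by metis
  qed
  then show ?thesis
    by (simp add: case_prod_unfold)
qed

text \<open>One assignment suffices, with the register just past the input as scratch space.\<close>

lemma poly_time_nth:
  assumes "\<And>i. i \<in> I \<Longrightarrow> length (inp i) = m" "0 < n" "n < m"
  shows "poly_time I inp (\<lambda>i. [inp i ! n])"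
proof (rule poly_timeI[of _ "assign m 0 n" _ "[:3, 11:]"])
  fix i assume i: "i \<in> I"
  let ?n = "sum_list (map length (inp i))"
  have "length (inp i ! 0) \<le> ?n" "length (inp i ! n) \<le> ?n"
    using assms i by (simp_all add: length_nth_le_sum_list)
  then have "runs (assign m 0 n) (load (inp i @ [[]])) (11 * ?n + 3)
      (load ((inp i @ [[]])[0 := (inp i @ [[]]) ! n]))"
    using assms i by (intro runs_assign) (auto simp: nth_append)
  then have "runs (assign m 0 n) (load (inp i)) (poly [:3, 11:] ?n)
      (load ((inp i @ [[]])[0 := (inp i @ [[]]) ! n]))"
    by (simp add: load_append_Nil algebra_simps)
  moreover have "load ((inp i @ [[]])[0 := (inp i @ [[]]) ! n]) 0 = inp i ! n"
    using assms i by (simp add: load_nth nth_append)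
  ultimately show "\<exists>s. runs (assign m 0 n) (load (inp i)) (poly [:3, 11:] ?n) s \<and> s 0 = inp i ! n"
    by blast
qed

lemma poly_time_mono: "poly_time I inp out \<Longrightarrow> I' \<subseteq> I \<Longrightarrow> poly_time I' inp out"
  unfolding poly_time_def by (meson subsetD)

text \<open>Both components are fixed before the first random choice of the signer.\<close>

lemma set_bl_sign:
  assumes "\<sigma> \<in> set_pmf (bl_sign P h pk f cred bsn m)"
  shows "sig_J \<sigma> = h bsn" "sig_K \<sigma> = h bsn [^]\<^bsub>pp_J P\<^esub> f"
  using assms by (auto simp: bl_sign_def Let_def split: prod.splits)

text \<open>
  The first two components of an ambiguous tuple are the two basenames, so truncating the output of
  the adversary yields a collision finder.
\<close>

lemma negligible_ambiguous_bsn: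
  assumes "collision_resistant h" "ppt A"
  shows "negligible_fun (\<lambda>\<eta>. measure_pmf.prob (A \<eta>)
    (ambiguous_bsn (brickell_li P h) (bl_verify_bsn h) \<eta>))"
proof (rule negligible_fun_mono)
  let ?C = "\<lambda>\<eta>. {out. \<exists>x x'. out = [x, x'] \<and> x \<noteq> x' \<and> h \<eta> x = h \<eta> x'}"
  show "negligible_fun (\<lambda>\<eta>. measure_pmf.prob (map_pmf (take 2) (A \<eta>)) (?C \<eta>))"
    using assms ppt_take unfolding collision_resistant_def by blast
  fix \<eta>
  \<comment> \<open>The two acceptances give
    \<open>h \<eta> bsn = sig_J \<sigma> = h \<eta> bsn'\<close>, and \<open>take 2\<close> keeps
    exactly these basenames.\<close>
  have "ambiguous_bsn (brickell_li P h) (bl_verify_bsn h) \<eta> \<subseteq> take 2 -` ?C \<eta>"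
    by (auto simp: ambiguous_bsn_def bl_verify_bsn_def)
  then show "\<bar>measure_pmf.prob (A \<eta>) (ambiguous_bsn (brickell_li P h) (bl_verify_bsn h) \<eta>)\<bar> \<le>
      \<bar>measure_pmf.prob (map_pmf (take 2) (A \<eta>)) (?C \<eta>)\<bar>"
    by (simp add: measure_pmf.finite_measure_mono)
qed

theorem theorem6:
  fixes P :: "nat \<Rightarrow> bl_params" and h :: "nat \<Rightarrow> bits \<Rightarrow> bits"
  assumes "\<And>\<eta>. bl_params_ok (P \<eta>)"
    and "efficient_group (\<lambda>\<eta>. pp_J (P \<eta>))"
    and "cr_hash (\<lambda>\<eta>. pp_J (P \<eta>)) h"
  shows "instantly_linkable_via (brickell_li P h) (bl_nym_gen P h) bl_nym_extract (bl_verify_bsn h)"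
proof -
  have monoid: "monoid (pp_J (P \<eta>))" for \<eta>
    using assms(1)[of \<eta>] by (simp add: bl_params_ok_def group.is_monoid)
  have h: "\<And>\<eta> x. h \<eta> x \<in> carrier (pp_J (P \<eta>))"
    and time_h: "poly_time UNIV (\<lambda>(\<eta>, x). [unary \<eta>, x]) (\<lambda>(\<eta>, x). [h \<eta> x])"
    and cr: "collision_resistant h"
    using assms(3) by (auto simp: cr_hash_def)
  \<comment> \<open>Secret keys start at 1, so the exponents are positive.\<close>
  have nym_gen: "poly_time {(\<eta>, f, bsn). f \<in> {1..<pp_q (P \<eta>)}} (\<lambda>(\<eta>, f, bsn). [unary \<eta>, bin f, bsn])
      (\<lambda>(\<eta>, f, bsn). [h \<eta> bsn [^]\<^bsub>pp_J (P \<eta>)\<^esub> f])"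
    by (rule poly_time_mono[OF poly_time_power_hash[OF monoid assms(2) h time_h]]) auto
  \<comment> \<open>Position 0 is the security parameter, so the second signature component is at
    position 2 of ten.\<close>
  have "poly_time UNIV (\<lambda>(\<eta>, \<sigma>). unary \<eta> # bl_enc_sig \<sigma>)
      (\<lambda>i. [(case i of (\<eta>, \<sigma>) \<Rightarrow> unary \<eta> # bl_enc_sig \<sigma>) ! 2])"
    by (rule poly_time_nth[of _ _ 10]) (auto simp: bl_enc_sig_def)
  then have nym_extract: "poly_time UNIV (\<lambda>(\<eta>, \<sigma>). unary \<eta> # bl_enc_sig \<sigma>) (\<lambda>(\<eta>, \<sigma>). [sig_K \<sigma>])"
    by (simp add: bl_enc_sig_def case_prod_unfold)
  have verify_bsn: "poly_time UNIV (\<lambda>(\<eta>, \<sigma>, bsn). unary \<eta> # bl_enc_sig \<sigma> @ [bsn])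
      (\<lambda>(\<eta>, \<sigma>, bsn). [[sig_J \<sigma> = h \<eta> bsn]])"
    using poly_time_eq_hash[OF time_h, of "\<lambda>\<sigma>. tl (bl_enc_sig \<sigma>)" sig_J]
    by (simp add: bl_enc_sig_def)
  \<comment> \<open>For two valid signatures \<open>bl_link\<close> is in its \<open>Some\<close>
    case and compares the \<open>sig_K\<close> components, which are what
    \<open>bl_nym_extract\<close> returns.\<close>
  show ?thesis
    unfolding instantly_linkable_via_def
    using nym_gen nym_extract verify_bsn negligible_ambiguous_bsn[OF cr, of _ P]
    by (auto simp: brickell_li_def bl_nym_gen_def bl_nym_extract_def bl_verify_bsn_def
        valid_sig_def bl_link_def set_bl_sign)
qed

end
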